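(* Let $\mathcal{A}$ be an abelian category, $n\geq 1$, $I=\{1,\dots,n\}$, let $G=(G_i)_{i\in I}$ be a family of additive left exact endofunctors of $\mathcal{A}$, each $G_i$ being the right adjoint of an endofunctor $F_i$ of $\mathcal{A}$, with a coassociative family $\Psi=(\Psi_{i,j}:G_{i+j}\to G_iG_j)$ of natural transformations. Let $E$ be an object of $\mathcal{A}$. An object $(X,f)$ of the left $n$-trivial extension $G\rtimes_n\mathcal{A}$ is in $\mathrm{Prod}(H(E))$ if and only if $K(X,f)\in\mathrm{Prod}(E)$ and $(X,f)\cong H(K(X,f))$.
   Context: $\Psi$ consists of natural transformations $\Psi_{i,j}:G_{i+j}\to G_iG_j$ for $i,j\in I$ with $i+j\in I$; it is coassociative if $G_i((\Psi_{j,k})_X)\circ(\Psi_{i,j+k})_X=(\Psi_{i,j})_{G_kX}\circ(\Psi_{i+j,k})_X$ for all objects $X$ and all $i,j,k\in I$ with $i+j+k\in I$. Objects of $G\rtimes_n\mathcal{A}$ are pairs $(X,g)$ with $X$ in $\mathcal{A}$ and $g=(g_i:X\to G_iX)_{i\in I}$ such that for all $i,j\in I$: $G_i(g_j)\circ g_i=(\Psi_{i,j})_X\circ g_{i+j}$ if $i+j\leq n$, and $G_i(g_j)\circ g_i=0$ if $i+j>n$. A morphism $(X,\alpha)\to(Y,\beta)$ is a morphism $\gamma:X\to Y$ in $\mathcal{A}$ with $\beta_i\circ\gamma=G_i(\gamma)\circ\alpha_i$ for all $i$. Functor $H:\mathcal{A}\to G\rtimes_n\mathcal{A}$: $H(X)=(G_nX\oplus\cdots\oplus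 G_1X\oplus X,\lambda)$, where $\lambda_i:G_nX\oplus\cdots\oplus G_1X\oplus X\to G_iG_nX\oplus\cdots\oplus G_iG_1X\oplus G_iX$ has component $\mathrm{id}:G_iX\to G_iX$, components $(\Psi_{i,j})_X:G_{i+j}X\to G_iG_jX$ for each $j$ with $i+j\leq n$, and all other components zero; $H(\alpha)=\mathrm{diag}(G_n\alpha,\dots,G_1\alpha,\alpha)$. Functor $K:G\rtimes_n\mathcal{A}\to\mathcal{A}$: $K(X,g)=\operatorname{Ker}\big((g_i)_i:X\to\bigoplus_{i\in I}G_iX\big)$, with the induced maps on morphisms. For an object $Q$ of a category, $\mathrm{Prod}(Q)$ is the class of objects isomorphic to direct summands of direct products of copies of $Q$. *)

theory Defs
  imports "HOL-Algebra.FiniteProduct"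
begin

section \<open>Categories\<close>

record ('o, 'm) cat =
  Obj :: "'o set"
  Arr :: "'m set"
  Dom :: "'m \<Rightarrow> 'o"
  Cod :: "'m \<Rightarrow> 'o"
  Ident :: "'o \<Rightarrow> 'm"
  Comp :: "'m \<Rightarrow> 'm \<Rightarrow> 'm"  (infixr \<open>\<cdot>\<index>\<close> 70)

definition Hom :: "('o, 'm, 'x) cat_scheme \<Rightarrow> 'o \<Rightarrow> 'o \<Rightarrow> 'm set"
  where "Hom C X Y = {f \<in> Arr C. Dom C f = X \<and> Cod C f = Y}"

locale category =
  fixes C :: "('o, 'm, 'x) cat_scheme" (structure)
  assumes Dom_in: "f \<in> Arr C \<Longrightarrow> Dom C f \<in> Obj C"
    and Cod_in: "f \<in> Arr C \<Longrightarrow> Cod C f \<in> Obj C"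
    and Ident_in: "X \<in> Obj C \<Longrightarrow> Ident C X \<in> Hom C X X"
    and Comp_in: "\<lbrakk>f \<in> Hom C X Y; g \<in> Hom C Y Z\<rbrakk> \<Longrightarrow> g \<cdot> f \<in> Hom C X Z"
    and Comp_Ident: "f \<in> Hom C X Y \<Longrightarrow> f \<cdot> Ident C X = f"
    and Ident_Comp: "f \<in> Hom C X Y \<Longrightarrow> Ident C Y \<cdot> f = f"
    and Comp_assoc:
      "\<lbrakk>f \<in> Hom C W X; g \<in> Hom C X Y; h \<in> Hom C Y Z\<rbrakk> \<Longrightarrow> (h \<cdot> g) \<cdot> f = h \<cdot> (g \<cdot> f)"

definition isomorphic :: "('o, 'm, 'x) cat_scheme \<Rightarrow> 'o \<Rightarrow> 'o \<Rightarrow> bool"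
  where "isomorphic C X Y \<longleftrightarrow> X \<in> Obj C \<and> Y \<in> Obj C \<and>
    (\<exists>f \<in> Hom C X Y. \<exists>g \<in> Hom C Y X. g \<cdot>\<^bsub>C\<^esub> f = Ident C X \<and> f \<cdot>\<^bsub>C\<^esub> g = Ident C Y)"

definition monic :: "('o, 'm, 'x) cat_scheme \<Rightarrow> 'o \<Rightarrow> 'o \<Rightarrow> 'm \<Rightarrow> bool"
  where "monic C X Y f \<longleftrightarrow> f \<in> Hom C X Y \<and>
    (\<forall>W \<in> Obj C. \<forall>g \<in> Hom C W X. \<forall>h \<in> Hom C W X. f \<cdot>\<^bsub>C\<^esub> g = f \<cdot>\<^bsub>C\<^esub> h \<longrightarrow> g = h)"

definition epic :: "('o, 'm, 'x) cat_scheme \<Rightarrow> 'o \<Rightarrow> 'o \<Rightarrow> 'm \<Rightarrow> bool"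
  where "epic C X Y f \<longleftrightarrow> f \<in> Hom C X Y \<and>
    (\<forall>Z \<in> Obj C. \<forall>g \<in> Hom C Y Z. \<forall>h \<in> Hom C Y Z. g \<cdot>\<^bsub>C\<^esub> f = h \<cdot>\<^bsub>C\<^esub> f \<longrightarrow> g = h)"

definition is_product ::
  "('o, 'm, 'x) cat_scheme \<Rightarrow> 'i set \<Rightarrow> ('i \<Rightarrow> 'o) \<Rightarrow> 'o \<Rightarrow> ('i \<Rightarrow> 'm) \<Rightarrow> bool"
  where "is_product C S Y P p \<longleftrightarrow> P \<in> Obj C \<and> (\<forall>s\<in>S. p s \<in> Hom C P (Y s)) \<and>
    (\<forall>W \<in> Obj C. \<forall>q. (\<forall>s\<in>S. q s \<in> Hom C W (Y s)) \<longrightarrow>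
       (\<exists>!u. u \<in> Hom C W P \<and> (\<forall>s\<in>S. p s \<cdot>\<^bsub>C\<^esub> u = q s)))"


section \<open>Preadditive and abelian categories\<close>

record ('o, 'm) preadd_cat = "('o, 'm) cat" +
  Zero :: "'o \<Rightarrow> 'o \<Rightarrow> 'm"
  Add :: "'m \<Rightarrow> 'm \<Rightarrow> 'm"  (infixl \<open>\<boxplus>\<index>\<close> 65)

text \<open>The hom-groups are written additively in the category, but are groups in the sense of
  HOL-Algebra; finite sums of parallel morphisms are therefore \<open>finprod\<close>s.\<close>

definition HomGrp :: "('o, 'm, 'x) preadd_cat_scheme \<Rightarrow> 'o \<Rightarrow> 'o \<Rightarrow> 'm monoid"
  where "HomGrp C X Y = \<lparr>carrier = Hom C X Y, monoid.mult = Add C, one = Zero C X Y\<rparr>"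

definition HSum ::
  "('o, 'm, 'x) preadd_cat_scheme \<Rightarrow> 'o \<Rightarrow> 'o \<Rightarrow> ('i \<Rightarrow> 'm) \<Rightarrow> 'i set \<Rightarrow> 'm"
  where "HSum C X Y f J = finprod (HomGrp C X Y) f J"

locale preadditive_category = category C
  for C :: "('o, 'm, 'x) preadd_cat_scheme" (structure) +
  assumes HomGrp_comm_group:
      "\<lbrakk>X \<in> Obj C; Y \<in> Obj C\<rbrakk> \<Longrightarrow> comm_group (HomGrp C X Y)"
    and Comp_Add: "\<lbrakk>f \<in> Hom C X Y; g \<in> Hom C Y Z; h \<in> Hom C Y Z\<rbrakk>
      \<Longrightarrow> (g \<boxplus> h) \<cdot> f = g \<cdot> f \<boxplus> h \<cdot> f"
    and Add_Comp: "\<lbrakk>f \<in> Hom C X Y; g \<in> Hom C X Y; h \<in> Hom C Y Z\<rbrakk>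
      \<Longrightarrow> h \<cdot> (f \<boxplus> g) = h \<cdot> f \<boxplus> h \<cdot> g"

definition is_biproduct ::
  "('o, 'm, 'x) preadd_cat_scheme \<Rightarrow> nat set \<Rightarrow> (nat \<Rightarrow> 'o) \<Rightarrow>
     'o \<Rightarrow> (nat \<Rightarrow> 'm) \<Rightarrow> (nat \<Rightarrow> 'm) \<Rightarrow> bool"
  where "is_biproduct C J Y P \<iota> \<pi> \<longleftrightarrow> finite J \<and> P \<in> Obj C \<and>
    (\<forall>j\<in>J. Y j \<in> Obj C \<and> \<iota> j \<in> Hom C (Y j) P \<and> \<pi> j \<in> Hom C P (Y j)) \<and>
    (\<forall>j\<in>J. \<forall>k\<in>J. \<pi> j \<cdot>\<^bsub>C\<^esub> \<iota> k = (if j = k then Ident C (Y j) else Zero C (Y k) (Y j))) \<and>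
    HSum C P P (\<lambda>j. \<iota> j \<cdot>\<^bsub>C\<^esub> \<pi> j) J = Ident C P"

definition is_kernel ::
  "('o, 'm, 'x) preadd_cat_scheme \<Rightarrow> 'o \<Rightarrow> 'o \<Rightarrow> 'm \<Rightarrow> 'o \<Rightarrow> 'm \<Rightarrow> bool"
  where "is_kernel C X Y f K k \<longleftrightarrow> f \<in> Hom C X Y \<and> k \<in> Hom C K X \<and> f \<cdot>\<^bsub>C\<^esub> k = Zero C K Y \<and>
    (\<forall>W \<in> Obj C. \<forall>h \<in> Hom C W X. f \<cdot>\<^bsub>C\<^esub> h = Zero C W Y \<longrightarrow>
       (\<exists>!u. u \<in> Hom C W K \<and> k \<cdot>\<^bsub>C\<^esub> u = h))"

definition is_cokernel ::
  "('o, 'm, 'x) preadd_cat_scheme \<Rightarrow> 'o \<Rightarrow> 'o \<Rightarrow> 'm \<Rightarrow> 'o \<Rightarrow> 'm \<Rightarrow> bool"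
  where "is_cokernel C X Y f Q q \<longleftrightarrow> f \<in> Hom C X Y \<and> q \<in> Hom C Y Q \<and> q \<cdot>\<^bsub>C\<^esub> f = Zero C X Q \<and>
    (\<forall>W \<in> Obj C. \<forall>h \<in> Hom C Y W. h \<cdot>\<^bsub>C\<^esub> f = Zero C X W \<longrightarrow>
       (\<exists>!u. u \<in> Hom C Q W \<and> u \<cdot>\<^bsub>C\<^esub> q = h))"

text \<open>The empty biproduct is a zero object.\<close>

locale abelian_category = preadditive_category C
  for C :: "('o, 'm, 'x) preadd_cat_scheme" (structure) +
  assumes biproduct_exists:
      "\<lbrakk>finite J; \<And>j. j \<in> J \<Longrightarrow> B j \<in> Obj C\<rbrakk> \<Longrightarrow> \<exists>P \<iota> \<pi>. is_biproduct C J B P \<iota> \<pi>"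
    and kernel_exists: "f \<in> Hom C X Y \<Longrightarrow> \<exists>K k. is_kernel C X Y f K k"
    and cokernel_exists: "f \<in> Hom C X Y \<Longrightarrow> \<exists>Q q. is_cokernel C X Y f Q q"
    and monic_is_kernel: "monic C K X k \<Longrightarrow> \<exists>Y f. is_kernel C X Y f K k"
    and epic_is_cokernel: "epic C Y Q q \<Longrightarrow> \<exists>X f. is_cokernel C X Y f Q q"

definition biprod ::
  "('o, 'm, 'x) preadd_cat_scheme \<Rightarrow> nat set \<Rightarrow> (nat \<Rightarrow> 'o) \<Rightarrow> 'o \<times> (nat \<Rightarrow> 'm) \<times> (nat \<Rightarrow> 'm)"
  where "biprod C J Y = (SOME (P, \<iota>, \<pi>). is_biproduct C J Y P \<iota> \<pi>)"

abbreviation "biprod_ob C J Y \<equiv> fst (biprod C J Y)"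
abbreviation "biprod_in C J Y \<equiv> fst (snd (biprod C J Y))"
abbreviation "biprod_pr C J Y \<equiv> snd (snd (biprod C J Y))"

definition ker :: "('o, 'm, 'x) preadd_cat_scheme \<Rightarrow> 'o \<Rightarrow> 'o \<Rightarrow> 'm \<Rightarrow> 'o \<times> 'm"
  where "ker C X Y f = (SOME (K, k). is_kernel C X Y f K k)"

definition direct_summand :: "('o, 'm, 'x) preadd_cat_scheme \<Rightarrow> 'o \<Rightarrow> 'o \<Rightarrow> bool"
  where "direct_summand C X P \<longleftrightarrow>
    (\<exists>Y \<iota> \<pi>. is_biproduct C {0, 1} (\<lambda>j. if j = 0 then X else Y) P \<iota> \<pi>)"

text \<open>Index sets of products of copies of \<open>Q\<close> are taken from the type of morphisms. This is no
  restriction: a power of \<open>Q\<close> with any index set is also the power indexed by its own set of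
  projections, see lemma \<open>Prod_any_index\<close> below.\<close>

definition Prod :: "('o, 'm, 'x) preadd_cat_scheme \<Rightarrow> 'o \<Rightarrow> 'o set"
  where "Prod C Q = {X. \<exists>(S :: 'm set) P p X'.
    is_product C S (\<lambda>_. Q) P p \<and> direct_summand C X' P \<and> isomorphic C X X'}"

lemma Prod_any_index:
  fixes S :: "'i set"
  assumes P: "is_product C S (\<lambda>_. Q) P p"
    and X: "direct_summand C X' P" "isomorphic C X X'"
  shows "X \<in> Prod C Q"
proof -
  have "is_product C (p ` S) (\<lambda>_. Q) P (\<lambda>m. m)"
    unfolding is_product_def
  proof (intro conjI ballI allI impI)
    show "P \<in> Obj C" using P by (simp add: is_product_def)
    show "m \<in> Hom C P Q" if "m \<in> p ` S" for m
      using P that by (auto simp: is_product_def)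
    fix W q assume W: "W \<in> Obj C" and q: "\<forall>m\<in>p ` S. q m \<in> Hom C W Q"
    from q have "\<forall>s\<in>S. q (p s) \<in> Hom C W Q" by simp
    from P[unfolded is_product_def, THEN conjunct2, THEN conjunct2, THEN bspec, OF W,
        THEN spec, THEN mp, OF this]
    show "\<exists>!u. u \<in> Hom C W P \<and> (\<forall>m\<in>p ` S. m \<cdot>\<^bsub>C\<^esub> u = q m)" by simp
  qed
  with X show ?thesis unfolding Prod_def by blast
qed


section \<open>Functors\<close>

record ('o, 'm, 'p, 'q) ftor =
  OMap :: "'o \<Rightarrow> 'p"
  AMap :: "'m \<Rightarrow> 'q"

type_synonym ('o, 'm) endoftor = "('o, 'm, 'o, 'm) ftor"

definition fcomp ::
  "('p, 'q, 'r, 's) ftor \<Rightarrow> ('o, 'm, 'p, 'q) ftor \<Rightarrow> ('o, 'm, 'r, 's) ftor"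
  where "fcomp G F = \<lparr>OMap = OMap G \<circ> OMap F, AMap = AMap G \<circ> AMap F\<rparr>"

locale is_functor = dom: category C + cod: category D
  for C :: "('o, 'm, 'x) cat_scheme" and D :: "('p, 'q, 'y) cat_scheme" +
  fixes F :: "('o, 'm, 'p, 'q) ftor"
  assumes OMap_in: "X \<in> Obj C \<Longrightarrow> OMap F X \<in> Obj D"
    and AMap_in: "f \<in> Hom C X Y \<Longrightarrow> AMap F f \<in> Hom D (OMap F X) (OMap F Y)"
    and AMap_Ident: "X \<in> Obj C \<Longrightarrow> AMap F (Ident C X) = Ident D (OMap F X)"
    and AMap_Comp: "\<lbrakk>f \<in> Hom C X Y; g \<in> Hom C Y Z\<rbrakk>
      \<Longrightarrow> AMap F (g \<cdot>\<^bsub>C\<^esub> f) = AMap F g \<cdot>\<^bsub>D\<^esub> AMap F f"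

definition additive :: "('o, 'm, 'x) preadd_cat_scheme \<Rightarrow> ('p, 'q, 'y) preadd_cat_scheme \<Rightarrow>
    ('o, 'm, 'p, 'q) ftor \<Rightarrow> bool"
  where "additive C D F \<longleftrightarrow> (\<forall>X \<in> Obj C. \<forall>Y \<in> Obj C. \<forall>f \<in> Hom C X Y. \<forall>g \<in> Hom C X Y.
    AMap F (f \<boxplus>\<^bsub>C\<^esub> g) = AMap F f \<boxplus>\<^bsub>D\<^esub> AMap F g)"

text \<open>A sequence \<open>0 \<rightarrow> K \<rightarrow> X \<rightarrow> Y\<close> is exact precisely if its first map is a kernel of its second
  one; left exactness is preservation of such sequences.\<close>

definition left_exact :: "('o, 'm, 'x) preadd_cat_scheme \<Rightarrow> ('p, 'q, 'y) preadd_cat_scheme \<Rightarrow>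
    ('o, 'm, 'p, 'q) ftor \<Rightarrow> bool"
  where "left_exact C D F \<longleftrightarrow> (\<forall>X Y f K k. is_kernel C X Y f K k \<longrightarrow>
    is_kernel D (OMap F X) (OMap F Y) (AMap F f) (OMap F K) (AMap F k))"

definition adjoint :: "('o, 'm, 'x) cat_scheme \<Rightarrow> ('p, 'q, 'y) cat_scheme \<Rightarrow>
    ('o, 'm, 'p, 'q) ftor \<Rightarrow> ('p, 'q, 'o, 'm) ftor \<Rightarrow> bool"
  where "adjoint C D F G \<longleftrightarrow> (\<exists>\<phi>.
    (\<forall>X \<in> Obj C. \<forall>Y \<in> Obj D.
       bij_betw (\<phi> X Y) (Hom D (OMap F X) Y) (Hom C X (OMap G Y))) \<and>
    (\<forall>X' \<in> Obj C. \<forall>X \<in> Obj C. \<forall>Y \<in> Obj D. \<forall>Y' \<in> Obj D.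
       \<forall>a \<in> Hom C X' X. \<forall>h \<in> Hom D (OMap F X) Y. \<forall>b \<in> Hom D Y Y'.
         \<phi> X' Y' (b \<cdot>\<^bsub>D\<^esub> h \<cdot>\<^bsub>D\<^esub> AMap F a) = AMap G b \<cdot>\<^bsub>C\<^esub> \<phi> X Y h \<cdot>\<^bsub>C\<^esub> a))"

definition nat_trans :: "('o, 'm, 'x) cat_scheme \<Rightarrow> ('p, 'q, 'y) cat_scheme \<Rightarrow>
    ('o, 'm, 'p, 'q) ftor \<Rightarrow> ('o, 'm, 'p, 'q) ftor \<Rightarrow> ('o \<Rightarrow> 'q) \<Rightarrow> bool"
  where "nat_trans C D F G \<tau> \<longleftrightarrow>
    (\<forall>X \<in> Obj C. \<tau> X \<in> Hom D (OMap F X) (OMap G X)) \<and>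
    (\<forall>X \<in> Obj C. \<forall>Y \<in> Obj C. \<forall>f \<in> Hom C X Y.
       AMap G f \<cdot>\<^bsub>D\<^esub> \<tau> X = \<tau> Y \<cdot>\<^bsub>D\<^esub> AMap F f)"


section \<open>The left \<open>n\<close>-trivial extension\<close>

definition nat_trans_family :: "('o, 'm, 'x) preadd_cat_scheme \<Rightarrow> nat \<Rightarrow>
    (nat \<Rightarrow> ('o, 'm) endoftor) \<Rightarrow> (nat \<Rightarrow> nat \<Rightarrow> 'o \<Rightarrow> 'm) \<Rightarrow> bool"
  where "nat_trans_family A n G \<Psi> \<longleftrightarrow> (\<forall>i\<in>{1..n}. \<forall>j\<in>{1..n}. i + j \<in> {1..n} \<longrightarrow>
    nat_trans A A (G (i + j)) (fcomp (G i) (G j)) (\<Psi> i j))"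

definition coassociative :: "('o, 'm, 'x) preadd_cat_scheme \<Rightarrow> nat \<Rightarrow>
    (nat \<Rightarrow> ('o, 'm) endoftor) \<Rightarrow> (nat \<Rightarrow> nat \<Rightarrow> 'o \<Rightarrow> 'm) \<Rightarrow> bool"
  where "coassociative A n G \<Psi> \<longleftrightarrow>
    (\<forall>X \<in> Obj A. \<forall>i\<in>{1..n}. \<forall>j\<in>{1..n}. \<forall>k\<in>{1..n}. i + j + k \<in> {1..n} \<longrightarrow>
       AMap (G i) (\<Psi> j k X) \<cdot>\<^bsub>A\<^esub> \<Psi> i (j + k) X = \<Psi> i j (OMap (G k) X) \<cdot>\<^bsub>A\<^esub> \<Psi> (i + j) k X)"

text \<open>Families indexed by \<open>{1..n}\<close> are total functions that are \<open>undefined\<close> elsewhere, so that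
  equality of objects is equality of families.\<close>

type_synonym ('o, 'm) text_obj = "'o \<times> (nat \<Rightarrow> 'm)"

definition TObj :: "('o, 'm, 'x) preadd_cat_scheme \<Rightarrow> nat \<Rightarrow>
    (nat \<Rightarrow> ('o, 'm) endoftor) \<Rightarrow> (nat \<Rightarrow> nat \<Rightarrow> 'o \<Rightarrow> 'm) \<Rightarrow> ('o, 'm) text_obj set"
  where "TObj A n G \<Psi> = {(X, g). X \<in> Obj A \<and> g \<in> extensional {1..n} \<and>
    (\<forall>i\<in>{1..n}. g i \<in> Hom A X (OMap (G i) X)) \<and>
    (\<forall>i\<in>{1..n}. \<forall>j\<in>{1..n}. AMap (G i) (g j) \<cdot>\<^bsub>A\<^esub> g i =
       (if i + j \<le> n then \<Psi> i j X \<cdot>\<^bsub>A\<^esub> g (i + j)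
        else Zero A X (OMap (G i) (OMap (G j) X))))}"

text \<open>A morphism carries its source and target along, since the same morphism of \<open>A\<close> may underlie
  morphisms between different objects of the extension.\<close>

type_synonym ('o, 'm) text_arr = "('o, 'm) text_obj \<times> ('o, 'm) text_obj \<times> 'm"

definition TArr :: "('o, 'm, 'x) preadd_cat_scheme \<Rightarrow> nat \<Rightarrow>
    (nat \<Rightarrow> ('o, 'm) endoftor) \<Rightarrow> (nat \<Rightarrow> nat \<Rightarrow> 'o \<Rightarrow> 'm) \<Rightarrow> ('o, 'm) text_arr set"
  where "TArr A n G \<Psi> = {((X, \<alpha>), (Y, \<beta>), \<gamma>).
    (X, \<alpha>) \<in> TObj A n G \<Psi> \<and> (Y, \<beta>) \<in> TObj A n G \<Psi> \<and> \<gamma> \<in> Hom A X Y \<and>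
    (\<forall>i\<in>{1..n}. \<beta> i \<cdot>\<^bsub>A\<^esub> \<gamma> = AMap (G i) \<gamma> \<cdot>\<^bsub>A\<^esub> \<alpha> i)}"

definition triv_ext :: "('o, 'm, 'x) preadd_cat_scheme \<Rightarrow> nat \<Rightarrow>
    (nat \<Rightarrow> ('o, 'm) endoftor) \<Rightarrow> (nat \<Rightarrow> nat \<Rightarrow> 'o \<Rightarrow> 'm) \<Rightarrow>
    (('o, 'm) text_obj, ('o, 'm) text_arr) preadd_cat"
  where "triv_ext A n G \<Psi> = \<lparr>
    Obj = TObj A n G \<Psi>,
    Arr = TArr A n G \<Psi>,
    Dom = (\<lambda>(s, t, \<gamma>). s),
    Cod = (\<lambda>(s, t, \<gamma>). t),
    Ident = (\<lambda>s. (s, s, Ident A (fst s))),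
    Comp = (\<lambda>(s', t', \<gamma>') (s, t, \<gamma>). (s, t', \<gamma>' \<cdot>\<^bsub>A\<^esub> \<gamma>)),
    Zero = (\<lambda>s t. (s, t, Zero A (fst s) (fst t))),
    Add = (\<lambda>(s', t', \<gamma>') (s, t, \<gamma>). (s, t, \<gamma>' \<boxplus>\<^bsub>A\<^esub> \<gamma>))\<rparr>"


subsection \<open>The functor \<open>H\<close>\<close>

text \<open>\<open>Gs\<close> is the family \<open>G\<close> extended by \<open>G\<^sub>0 = Id\<close>, so that the object underlying \<open>H X\<close> is the
  biproduct of the \<open>G\<^sub>k X\<close> for \<open>k \<in> {0..n}\<close>.\<close>

definition Gs :: "(nat \<Rightarrow> ('o, 'm) endoftor) \<Rightarrow> nat \<Rightarrow> ('o, 'm) endoftor"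
  where "Gs G k = (if k = 0 then \<lparr>OMap = (\<lambda>X. X), AMap = (\<lambda>f. f)\<rparr> else G k)"

abbreviation "Gsum A n G X \<equiv> biprod_ob A {0..n} (\<lambda>k. OMap (Gs G k) X)"
abbreviation "Gin A n G X \<equiv> biprod_in A {0..n} (\<lambda>k. OMap (Gs G k) X)"
abbreviation "Gpr A n G X \<equiv> biprod_pr A {0..n} (\<lambda>k. OMap (Gs G k) X)"

text \<open>\<open>Hcomp A G \<Psi> X i k j\<close> is the component \<open>G\<^sub>k X \<rightarrow> G\<^sub>i (G\<^sub>j X)\<close> of the structure map
  \<open>\<lambda>\<^sub>i\<close> of \<open>H X\<close>.\<close>

definition Hcomp :: "('o, 'm, 'x) preadd_cat_scheme \<Rightarrow> (nat \<Rightarrow> ('o, 'm) endoftor) \<Rightarrow>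
    (nat \<Rightarrow> nat \<Rightarrow> 'o \<Rightarrow> 'm) \<Rightarrow> 'o \<Rightarrow> nat \<Rightarrow> nat \<Rightarrow> nat \<Rightarrow> 'm"
  where "Hcomp A G \<Psi> X i k j =
    (if j = 0 \<and> k = i then Ident A (OMap (G i) X)
     else if j \<ge> 1 \<and> k = i + j then \<Psi> i j X
     else Zero A (OMap (Gs G k) X) (OMap (G i) (OMap (Gs G j) X)))"

text \<open>The direct sum of the \<open>G\<^sub>i (G\<^sub>j X)\<close> is identified with \<open>G\<^sub>i\<close> of the direct sum of the
  \<open>G\<^sub>j X\<close> by the images under \<open>G\<^sub>i\<close> of the injections.\<close>

definition Hstr :: "('o, 'm, 'x) preadd_cat_scheme \<Rightarrow> nat \<Rightarrow> (nat \<Rightarrow> ('o, 'm) endoftor) \<Rightarrow>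
    (nat \<Rightarrow> nat \<Rightarrow> 'o \<Rightarrow> 'm) \<Rightarrow> 'o \<Rightarrow> nat \<Rightarrow> 'm"
  where "Hstr A n G \<Psi> X = (\<lambda>i\<in>{1..n}.
    HSum A (Gsum A n G X) (OMap (G i) (Gsum A n G X))
      (\<lambda>(k, j). AMap (G i) (Gin A n G X j) \<cdot>\<^bsub>A\<^esub> Hcomp A G \<Psi> X i k j \<cdot>\<^bsub>A\<^esub> Gpr A n G X k)
      ({0..n} \<times> {0..n}))"

definition Hob :: "('o, 'm, 'x) preadd_cat_scheme \<Rightarrow> nat \<Rightarrow> (nat \<Rightarrow> ('o, 'm) endoftor) \<Rightarrow>
    (nat \<Rightarrow> nat \<Rightarrow> 'o \<Rightarrow> 'm) \<Rightarrow> 'o \<Rightarrow> ('o, 'm) text_obj"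
  where "Hob A n G \<Psi> X = (Gsum A n G X, Hstr A n G \<Psi> X)"

definition Hfun :: "('o, 'm, 'x) preadd_cat_scheme \<Rightarrow> nat \<Rightarrow> (nat \<Rightarrow> ('o, 'm) endoftor) \<Rightarrow>
    (nat \<Rightarrow> nat \<Rightarrow> 'o \<Rightarrow> 'm) \<Rightarrow> ('o, 'm, ('o, 'm) text_obj, ('o, 'm) text_arr) ftor"
  where "Hfun A n G \<Psi> = \<lparr>
    OMap = Hob A n G \<Psi>,
    AMap = (\<lambda>\<alpha>. let X = Dom A \<alpha>; Y = Cod A \<alpha> in
      (Hob A n G \<Psi> X, Hob A n G \<Psi> Y,
       HSum A (Gsum A n G X) (Gsum A n G Y)
         (\<lambda>k. Gin A n G Y k \<cdot>\<^bsub>A\<^esub> AMap (Gs G k) \<alpha> \<cdot>\<^bsub>A\<^esub> Gpr A n G X k) {0..n}))\<rparr>"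


subsection \<open>The functor \<open>K\<close>\<close>

definition Kker :: "('o, 'm, 'x) preadd_cat_scheme \<Rightarrow> nat \<Rightarrow> (nat \<Rightarrow> ('o, 'm) endoftor) \<Rightarrow>
    ('o, 'm) text_obj \<Rightarrow> 'o \<times> 'm"
  where "Kker A n G = (\<lambda>(X, g).
    let Y = (\<lambda>i. OMap (G i) X); B = biprod_ob A {1..n} Y in
    ker A X B (HSum A X B (\<lambda>i. biprod_in A {1..n} Y i \<cdot>\<^bsub>A\<^esub> g i) {1..n}))"

definition Kfun :: "('o, 'm, 'x) preadd_cat_scheme \<Rightarrow> nat \<Rightarrow> (nat \<Rightarrow> ('o, 'm) endoftor) \<Rightarrow>
    (('o, 'm) text_obj, ('o, 'm) text_arr, 'o, 'm) ftor"
  where "Kfun A n G = \<lparr>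
    OMap = (\<lambda>s. fst (Kker A n G s)),
    AMap = (\<lambda>(s, t, \<gamma>). THE u. u \<in> Hom A (fst (Kker A n G s)) (fst (Kker A n G t)) \<and>
      snd (Kker A n G t) \<cdot>\<^bsub>A\<^esub> u = \<gamma> \<cdot>\<^bsub>A\<^esub> snd (Kker A n G s))\<rparr>"

end

(* The functor H is right adjoint to the forgetful functor (X, g) |-> X, a comodule map into H Y
   being determined by its component in Y, and K is right adjoint to W |-> (W, 0); so both preserve
   products, and K (H Y) = Y. Hence a product P of copies of H E is H Z for the product Z = K P of
   copies of E. If s is a retract of H Z, then K s is a retract of Z, and the retraction induces
   a : H (K s) -> s and b : s -> H (K s) such that a b and b a restrict to the identity on K.
   An endomorphism of a comodule with this property is invertible: left exactness of the G_i allows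
   a left inverse to be built step by step along the finite filtration of X by the common kernels
   of the g_j with j > m. Hence s is isomorphic to H (K s). *)

theory Submission
  imports Defs
begin

text \<open>Without elements or subobjects, an element of \<open>X\<close> is a morphism
  \<open>h : W -> X\<close>, and membership in K or in a step of the filtration means that certain
  composites \<open>snd s j \<cdot> h\<close> vanish. A kernel object of the filtration is formed
  only where left exactness is applied to it. No adjunction is formed as such. For H it enters
  through existence (\<open>cofree_lift_comod_hom\<close>, \<open>pr_0_cofree_lift\<close>) and
  uniqueness (\<open>cofree_eqI\<close>), for K through \<open>Kin_lift\<close> and
  \<open>Kin_eqI\<close>. The invertibility argument asks for the identity on K, not merely for an
  isomorphism there, because the correction of a partial left inverse relies on
  \<open>u \<cdot> d = d\<close> for the error term \<open>d\<close>, which lies in K. Summands are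
  treated asymmetrically: the extension is shown to be preadditive only, and in a preadditive
  category a retract need not have a complement. Hence the forward direction carries retracts and
  splits them in \<open>A\<close>, where kernels exist, while the backward direction obtains the
  complement from H.\<close>

section \<open>Categories and preadditive categories\<close>

context category
begin

lemma Hom_iff: "f \<in> Hom C X Y \<longleftrightarrow> f \<in> Arr C \<and> Dom C f = X \<and> Cod C f = Y"
  by (simp add: Hom_def)

lemma Hom_Obj: "f \<in> Hom C X Y \<Longrightarrow> X \<in> Obj C \<and> Y \<in> Obj C"
  using Dom_in Cod_in by (auto simp: Hom_iff)

text \<open>The category laws are restated with \<open>Arr\<close>, \<open>Dom\<close> and
  \<open>Cod\<close> for the simplifier: in the \<open>Hom\<close> form the middle object of a
  composite occurs only in premises and would have to be guessed, whereas here it is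
  computed.\<close>

lemma arr_Comp [simp]:
  assumes "f \<in> Arr C" "g \<in> Arr C" "Dom C g = Cod C f"
  shows "g \<cdot> f \<in> Arr C" "Dom C (g \<cdot> f) = Dom C f" "Cod C (g \<cdot> f) = Cod C g"
  using Comp_in[of f "Dom C f" "Cod C f" g "Cod C g"] assms by (auto simp: Hom_iff)

lemma arr_Ident [simp]:
  assumes "X \<in> Obj C"
  shows "Ident C X \<in> Arr C" "Dom C (Ident C X) = X" "Cod C (Ident C X) = X"
  using Ident_in[OF assms] by (auto simp: Hom_iff)

lemma arr_Comp_Ident [simp]: "f \<in> Arr C \<Longrightarrow> Dom C f = X \<Longrightarrow> f \<cdot> Ident C X = f"
  using Comp_Ident[of f X "Cod C f"] by (simp add: Hom_iff)

lemma arr_Ident_Comp [simp]: "f \<in> Arr C \<Longrightarrow> Cod C f = Y \<Longrightarrow> Ident C Y \<cdot> f = f"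
  using Ident_Comp[of f "Dom C f" Y] by (simp add: Hom_iff)

lemma arr_assoc [simp]:
  assumes "f \<in> Arr C" "g \<in> Arr C" "h \<in> Arr C" "Dom C g = Cod C f" "Dom C h = Cod C g"
  shows "(h \<cdot> g) \<cdot> f = h \<cdot> (g \<cdot> f)"
  using Comp_assoc assms by (simp add: Hom_iff)

lemma isomorphicI:
  assumes "f \<in> Hom C X Y" "g \<in> Hom C Y X" "g \<cdot> f = Ident C X" "f \<cdot> g = Ident C Y"
  shows "isomorphic C X Y"
  unfolding isomorphic_def using assms Hom_Obj by blast

lemma isomorphic_refl: "X \<in> Obj C \<Longrightarrow> isomorphic C X X"
  by (rule isomorphicI[of "Ident C X" _ _ "Ident C X"]) (simp_all add: Hom_iff)

lemma isomorphic_trans: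
  assumes "isomorphic C X Y" "isomorphic C Y Z"
  shows "isomorphic C X Z"
proof -
  from assms(1) obtain f f' where f: "f \<in> Hom C X Y" "f' \<in> Hom C Y X"
    and ff: "f' \<cdot> f = Ident C X" "f \<cdot> f' = Ident C Y"
    unfolding isomorphic_def by blast
  from assms(2) obtain g g' where g: "g \<in> Hom C Y Z" "g' \<in> Hom C Z Y"
    and gg: "g' \<cdot> g = Ident C Y" "g \<cdot> g' = Ident C Z"
    unfolding isomorphic_def by blast
  have 1: "(f' \<cdot> g') \<cdot> (g \<cdot> f) = Ident C X"
    using f g ff arr_assoc[of f g g'] by (simp add: gg Hom_iff)
  have 2: "(g \<cdot> f) \<cdot> (f' \<cdot> g') = Ident C Z"
    using f g gg arr_assoc[of g' f' f] by (simp add: ff Hom_iff)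
  show ?thesis
    by (rule isomorphicI[OF _ _ 1 2]) (use f g in \<open>auto simp: Hom_iff\<close>)
qed

section \<open>Products and retracts\<close>

lemma is_productD:
  assumes "is_product C S Y P p"
  shows "P \<in> Obj C" "\<And>s. s \<in> S \<Longrightarrow> p s \<in> Hom C P (Y s)"
  using assms by (auto simp: is_product_def)

lemma is_product_lift:
  assumes "is_product C S Y P p" "W \<in> Obj C" "\<And>s. s \<in> S \<Longrightarrow> q s \<in> Hom C W (Y s)"
  obtains u where "u \<in> Hom C W P" "\<And>s. s \<in> S \<Longrightarrow> p s \<cdot> u = q s"
proof -
  from assms(3) have "\<forall>s\<in>S. q s \<in> Hom C W (Y s)" by blast
  then have "\<exists>!u. u \<in> Hom C W P \<and> (\<forall>s\<in>S. p s \<cdot> u = q s)"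
    using assms(1,2) unfolding is_product_def by (elim conjE) simp
  from ex1_implies_ex[OF this] obtain u where "u \<in> Hom C W P" "\<forall>s\<in>S. p s \<cdot> u = q s"
    by (elim exE conjE)
  then show ?thesis using that[of u] by simp
qed

lemma is_product_eqI:
  assumes P: "is_product C S Y P p" and u: "u \<in> Hom C W P" and v: "v \<in> Hom C W P"
    and eq: "\<And>s. s \<in> S \<Longrightarrow> p s \<cdot> u = p s \<cdot> v"
  shows "u = v"
proof -
  have "\<forall>s\<in>S. p s \<cdot> v \<in> Hom C W (Y s)"
    using is_productD[OF P] v by (auto intro: Comp_in)
  moreover have "W \<in> Obj C" using Hom_Obj[OF u] by simp
  ultimately have "\<exists>!w. w \<in> Hom C W P \<and> (\<forall>s\<in>S. p s \<cdot> w = p s \<cdot> v)"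
    using P[unfolded is_product_def, THEN conjunct2, THEN conjunct2, THEN bspec, THEN spec, THEN mp]
    by simp
  then show ?thesis using u v eq by (elim ex1E) metis
qed

lemma is_product_unique:
  assumes P: "is_product C S Y P p" and Q: "is_product C S Y Q q"
  shows "isomorphic C P Q"
proof -
  obtain u where u: "u \<in> Hom C P Q" and qu: "\<And>s. s \<in> S \<Longrightarrow> q s \<cdot> u = p s"
    using is_product_lift[OF Q is_productD[OF P]] by metis
  obtain v where v: "v \<in> Hom C Q P" and pv: "\<And>s. s \<in> S \<Longrightarrow> p s \<cdot> v = q s"
    using is_product_lift[OF P is_productD[OF Q]] by metis
  note PQ = is_productD[OF P] is_productD[OF Q]
  have "v \<cdot> u = Ident C P"
  proof (rule is_product_eqI[OF P])
    show "v \<cdot> u \<in> Hom C P P" using u v by (rule Comp_in)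
    show "Ident C P \<in> Hom C P P" using PQ by (simp add: Ident_in)
    show "p s \<cdot> v \<cdot> u = p s \<cdot> Ident C P" if "s \<in> S" for s
      using Comp_assoc[OF u v PQ(2)[OF that]] pv[OF that] qu[OF that] Comp_Ident[OF PQ(2)[OF that]]
      by simp
  qed
  moreover have "u \<cdot> v = Ident C Q"
  proof (rule is_product_eqI[OF Q])
    show "u \<cdot> v \<in> Hom C Q Q" using v u by (rule Comp_in)
    show "Ident C Q \<in> Hom C Q Q" using PQ by (simp add: Ident_in)
    show "q s \<cdot> u \<cdot> v = q s \<cdot> Ident C Q" if "s \<in> S" for s
      using Comp_assoc[OF v u PQ(4)[OF that]] pv[OF that] qu[OF that] Comp_Ident[OF PQ(4)[OF that]]
      by simp
  qed
  ultimately show ?thesis using isomorphicI u v by blast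
qed

text \<open>The working substitute for \<open>direct_summand\<close>: retracts compose in every
  category, and no complement has to be carried along.\<close>

definition retract :: "'o \<Rightarrow> 'o \<Rightarrow> bool"
  where "retract X Y \<longleftrightarrow> (\<exists>i\<in>Hom C X Y. \<exists>r\<in>Hom C Y X. r \<cdot> i = Ident C X)"

lemma isomorphic_retract: "isomorphic C X Y \<Longrightarrow> retract X Y"
  unfolding isomorphic_def retract_def by blast

lemma retract_trans:
  assumes "retract X Y" "retract Y Z"
  shows "retract X Z"
proof -
  from assms(1) obtain f f' where f: "f \<in> Hom C X Y" "f' \<in> Hom C Y X" "f' \<cdot> f = Ident C X"
    unfolding retract_def by blast
  from assms(2) obtain g g' where g: "g \<in> Hom C Y Z" "g' \<in> Hom C Z Y" "g' \<cdot> g = Ident C Y"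
    unfolding retract_def by blast
  have "(f' \<cdot> g') \<cdot> (g \<cdot> f) = Ident C X"
    using f g arr_assoc[of f g g'] by (simp add: Hom_iff)
  then show ?thesis
    unfolding retract_def using Comp_in[OF f(1) g(1)] Comp_in[OF g(2) f(2)] by blast
qed

end

section \<open>Hom-groups and finite sums\<close>

context preadditive_category
begin

lemma carrier_HomGrp [simp]: "carrier (HomGrp C X Y) = Hom C X Y"
  and mult_HomGrp [simp]: "monoid.mult (HomGrp C X Y) = Add C"
  and one_HomGrp [simp]: "one (HomGrp C X Y) = Zero C X Y"
  by (simp_all add: HomGrp_def)

lemma arr_Zero [simp]:
  assumes "X \<in> Obj C" "Y \<in> Obj C"
  shows "Zero C X Y \<in> Arr C" "Dom C (Zero C X Y) = X" "Cod C (Zero C X Y) = Y"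
  using monoid.one_closed[OF comm_monoid.axioms(1)[OF comm_group.axioms(1)[OF HomGrp_comm_group[OF assms]]]]
  by (simp_all add: Hom_iff)

lemma Add_in: "f \<in> Hom C X Y \<Longrightarrow> g \<in> Hom C X Y \<Longrightarrow> f \<boxplus> g \<in> Hom C X Y"
  using monoid.m_closed[OF comm_monoid.axioms(1)[OF comm_group.axioms(1)[OF HomGrp_comm_group]], of X Y f g]
    Hom_Obj[of f X Y] by simp

lemma arr_Add [simp]:
  assumes "f \<in> Arr C" "g \<in> Arr C" "Dom C g = Dom C f" "Cod C g = Cod C f"
  shows "f \<boxplus> g \<in> Arr C" "Dom C (f \<boxplus> g) = Dom C f" "Cod C (f \<boxplus> g) = Cod C f"
  using Add_in[of f "Dom C f" "Cod C f" g] assms by (auto simp: Hom_iff)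

context
  fixes X Y assumes XY: "X \<in> Obj C" "Y \<in> Obj C"
begin

interpretation HG: comm_group "HomGrp C X Y"
  using XY by (rule HomGrp_comm_group)

lemma Add_assoc:
  "f \<in> Hom C X Y \<Longrightarrow> g \<in> Hom C X Y \<Longrightarrow> h \<in> Hom C X Y \<Longrightarrow> f \<boxplus> g \<boxplus> h = f \<boxplus> (g \<boxplus> h)"
  using HG.m_assoc by simp

lemma Add_comm: "f \<in> Hom C X Y \<Longrightarrow> g \<in> Hom C X Y \<Longrightarrow> f \<boxplus> g = g \<boxplus> f"
  using HG.m_comm by simp

lemma Add_Zero: "f \<in> Hom C X Y \<Longrightarrow> f \<boxplus> Zero C X Y = f"
  using HG.r_one by simp

lemma Zero_Add: "f \<in> Hom C X Y \<Longrightarrow> Zero C X Y \<boxplus> f = f"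
  using HG.l_one by simp

lemma Add_cancel:
  "f \<in> Hom C X Y \<Longrightarrow> g \<in> Hom C X Y \<Longrightarrow> h \<in> Hom C X Y \<Longrightarrow> f \<boxplus> g = f \<boxplus> h \<Longrightarrow> g = h"
  using HG.Units_l_cancel[of f g h] by simp

text \<open>The record has no negation. A difference is therefore obtained as a solution
  \<open>d\<close> of \<open>f \<boxplus> d = g\<close>, and identities about it are proved by
  \<open>Add_cancel\<close>.\<close>

lemma diff_exists:
  assumes "f \<in> Hom C X Y" "g \<in> Hom C X Y"
  obtains d where "d \<in> Hom C X Y" "f \<boxplus> d = g"
proof
  show "inv\<^bsub>HomGrp C X Y\<^esub> f \<boxplus> g \<in> Hom C X Y"
    using HG.m_closed[OF HG.inv_closed[of f], of g] assms by simp
  show "f \<boxplus> (inv\<^bsub>HomGrp C X Y\<^esub> f \<boxplus> g) = g"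
    using HG.m_assoc[of f "inv\<^bsub>HomGrp C X Y\<^esub> f" g] HG.r_inv[of f] HG.inv_closed[of f] HG.l_one assms
    by simp
qed

lemma HSum_in: "(\<And>j. j \<in> J \<Longrightarrow> f j \<in> Hom C X Y) \<Longrightarrow> HSum C X Y f J \<in> Hom C X Y"
  using HG.finprod_closed[of f J] by (simp add: HSum_def Pi_def)

lemma HSum_empty [simp]: "HSum C X Y f {} = Zero C X Y"
  by (simp add: HSum_def)

lemma HSum_insert:
  "finite J \<Longrightarrow> j \<notin> J \<Longrightarrow> (\<And>k. k \<in> insert j J \<Longrightarrow> f k \<in> Hom C X Y) \<Longrightarrow>
    HSum C X Y f (insert j J) = f j \<boxplus> HSum C X Y f J"
  using HG.finprod_insert[of J j f] by (simp add: HSum_def Pi_def)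

lemma HSum_cong:
  "(\<And>j. j \<in> J \<Longrightarrow> f j \<in> Hom C X Y) \<Longrightarrow> (\<And>j. j \<in> J \<Longrightarrow> f j = g j) \<Longrightarrow>
    HSum C X Y f J = HSum C X Y g J"
  unfolding HSum_def by (rule HG.finprod_cong') (auto simp: Pi_def)

lemma HSum_Zero: "(\<And>j. j \<in> J \<Longrightarrow> f j = Zero C X Y) \<Longrightarrow> HSum C X Y f J = Zero C X Y"
  using HG.finprod_one_eqI[of J f] by (simp add: HSum_def)

lemma HSum_single:
  assumes "finite J" "j \<in> J" "f j \<in> Hom C X Y" "\<And>k. k \<in> J \<Longrightarrow> k \<noteq> j \<Longrightarrow> f k = Zero C X Y"
  shows "HSum C X Y f J = f j"
proof -
  have Z: "Zero C X Y \<in> Hom C X Y" using XY by (simp add: Hom_iff)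
  have J: "J = insert j (J - {j})" using assms(2) by blast
  have "HSum C X Y f J = f j \<boxplus> HSum C X Y f (J - {j})"
    using HSum_insert[of "J - {j}" j f] assms Z J by (metis DiffD2 finite_Diff singletonI)
  also have "HSum C X Y f (J - {j}) = Zero C X Y"
    by (rule HSum_Zero) (use assms in auto)
  finally show ?thesis using Add_Zero assms(3) by simp
qed

end

text \<open>The axioms mention sums only, but \<open>0 + 0 = 0\<close> and distributivity give
  \<open>z f + z f = z f\<close>, and cancellation finishes.\<close>

lemma Zero_Comp [simp]:
  assumes "f \<in> Arr C" "Cod C f = Y" "Z \<in> Obj C"
  shows "Zero C Y Z \<cdot> f = Zero C (Dom C f) Z"
proof -
  let ?z = "Zero C Y Z"
  have Y: "Y \<in> Obj C" "Dom C f \<in> Obj C" using assms Dom_in Cod_in by auto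
  have z: "?z \<in> Hom C Y Z" using Y assms by (simp add: Hom_iff)
  have f: "f \<in> Hom C (Dom C f) Y" using assms by (simp add: Hom_iff)
  have zf: "?z \<cdot> f \<in> Hom C (Dom C f) Z" using f z by (rule Comp_in)
  have "?z \<cdot> f \<boxplus> ?z \<cdot> f = ?z \<cdot> f \<boxplus> Zero C (Dom C f) Z"
    using Comp_Add[OF f z z] Add_Zero[OF Y(1) assms(3) z] Add_Zero[OF Y(2) assms(3) zf] by simp
  then show ?thesis
    using Add_cancel[OF Y(2) assms(3) zf zf] Y assms by (simp add: Hom_iff)
qed

lemma Comp_Zero [simp]:
  assumes "f \<in> Arr C" "Dom C f = Y" "X \<in> Obj C"
  shows "f \<cdot> Zero C X Y = Zero C X (Cod C f)"
proof -
  let ?z = "Zero C X Y"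
  have Y: "Y \<in> Obj C" "Cod C f \<in> Obj C" using assms Dom_in Cod_in by auto
  have z: "?z \<in> Hom C X Y" using Y assms by (simp add: Hom_iff)
  have f: "f \<in> Hom C Y (Cod C f)" using assms by (simp add: Hom_iff)
  have fz: "f \<cdot> ?z \<in> Hom C X (Cod C f)" using z f by (rule Comp_in)
  have "f \<cdot> ?z \<boxplus> f \<cdot> ?z = f \<cdot> ?z \<boxplus> Zero C X (Cod C f)"
    using Add_Comp[OF z z f] Add_Zero[OF assms(3) Y(1) z] Add_Zero[OF assms(3) Y(2) fz] by simp
  then show ?thesis
    using Add_cancel[OF assms(3) Y(2) fz fz] Y assms by (simp add: Hom_iff)
qed

lemma Comp_HSum:
  assumes "finite J" "X \<in> Obj C" "\<And>j. j \<in> J \<Longrightarrow> f j \<in> Hom C X Y" "h \<in> Hom C Y Z"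
  shows "h \<cdot> HSum C X Y f J = HSum C X Z (\<lambda>j. h \<cdot> f j) J"
  using assms(1,3)
proof (induction J)
  case empty
  then show ?case using assms Hom_Obj[OF assms(4)] by (simp add: Hom_iff)
next
  case (insert j J)
  have O: "Y \<in> Obj C" "Z \<in> Obj C" using Hom_Obj[OF assms(4)] by auto
  have "HSum C X Y f J \<in> Hom C X Y"
    using insert by (intro HSum_in[OF assms(2) O(1)]) auto
  then have "h \<cdot> (f j \<boxplus> HSum C X Y f J) = h \<cdot> f j \<boxplus> HSum C X Z (\<lambda>j. h \<cdot> f j) J"
    using Add_Comp[OF insert.prems[OF insertI1] _ assms(4)] insert.IH[OF insert.prems[OF insertI2]] by simp
  then show ?case
    using HSum_insert[OF assms(2) O(1) insert.hyps(1,2) insert.prems]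
      HSum_insert[OF assms(2) O(2) insert.hyps(1,2) Comp_in[OF insert.prems assms(4)]]
    by simp
qed

lemma HSum_Comp:
  assumes "finite J" "Z \<in> Obj C" "\<And>j. j \<in> J \<Longrightarrow> f j \<in> Hom C Y Z" "h \<in> Hom C X Y"
  shows "HSum C Y Z f J \<cdot> h = HSum C X Z (\<lambda>j. f j \<cdot> h) J"
  using assms(1,3)
proof (induction J)
  case empty
  then show ?case using assms Hom_Obj[OF assms(4)] by (simp add: Hom_iff)
next
  case (insert j J)
  have O: "X \<in> Obj C" "Y \<in> Obj C" using Hom_Obj[OF assms(4)] by auto
  have "HSum C Y Z f J \<in> Hom C Y Z"
    using insert by (intro HSum_in[OF O(2) assms(2)]) auto
  then have "(f j \<boxplus> HSum C Y Z f J) \<cdot> h = f j \<cdot> h \<boxplus> HSum C X Z (\<lambda>j. f j \<cdot> h) J"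
    using Comp_Add[OF assms(4) insert.prems[OF insertI1]] insert.IH[OF insert.prems[OF insertI2]] by simp
  then show ?case
    using HSum_insert[OF O(2) assms(2) insert.hyps(1,2) insert.prems]
      HSum_insert[OF O(1) assms(2) insert.hyps(1,2) Comp_in[OF assms(4) insert.prems]]
    by simp
qed

section \<open>Biproducts, kernels and direct summands\<close>

lemma is_biproductD:
  assumes "is_biproduct C J Y P \<iota> \<pi>"
  shows "finite J" "P \<in> Obj C" "\<And>j. j \<in> J \<Longrightarrow> Y j \<in> Obj C"
    "\<And>j. j \<in> J \<Longrightarrow> \<iota> j \<in> Hom C (Y j) P" "\<And>j. j \<in> J \<Longrightarrow> \<pi> j \<in> Hom C P (Y j)"
    "\<And>j k. j \<in> J \<Longrightarrow> k \<in> J \<Longrightarrow> \<pi> j \<cdot> \<iota> k = (if j = k then Ident C (Y j) else Zero C (Y k) (Y j))"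
    "HSum C P P (\<lambda>j. \<iota> j \<cdot> \<pi> j) J = Ident C P"
  using assms unfolding is_biproduct_def by auto

text \<open>\<open>is_biproduct\<close> is purely equational; expanding each \<open>w\<close> as the
  sum of the \<open>\<iota> j \<cdot> (\<pi> j \<cdot> w)\<close> extracts from it that the
  projections are jointly monic.\<close>

lemma biproduct_eqI:
  assumes B: "is_biproduct C J Y P \<iota> \<pi>" and u: "u \<in> Hom C W P" and v: "v \<in> Hom C W P"
    and eq: "\<And>j. j \<in> J \<Longrightarrow> \<pi> j \<cdot> u = \<pi> j \<cdot> v"
  shows "u = v"
proof -
  note b = is_biproductD[OF B]
  have W: "W \<in> Obj C" using Hom_Obj[OF u] by simp
  have *: "w = HSum C W P (\<lambda>j. \<iota> j \<cdot> (\<pi> j \<cdot> w)) J" if w: "w \<in> Hom C W P" for w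
  proof -
    have "w = HSum C P P (\<lambda>j. \<iota> j \<cdot> \<pi> j) J \<cdot> w"
      using Ident_Comp[OF w] b(7) by simp
    also have "\<dots> = HSum C W P (\<lambda>j. (\<iota> j \<cdot> \<pi> j) \<cdot> w) J"
      by (rule HSum_Comp[OF b(1) b(2) Comp_in[OF b(5) b(4)] w])
    also have "\<dots> = HSum C W P (\<lambda>j. \<iota> j \<cdot> (\<pi> j \<cdot> w)) J"
    proof (rule HSum_cong[OF W b(2)])
      fix j assume j: "j \<in> J"
      show "(\<iota> j \<cdot> \<pi> j) \<cdot> w = \<iota> j \<cdot> (\<pi> j \<cdot> w)"
        using Comp_assoc[OF w b(5)[OF j] b(4)[OF j]] .
      show "(\<iota> j \<cdot> \<pi> j) \<cdot> w \<in> Hom C W P"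
        using Comp_in[OF w Comp_in[OF b(5)[OF j] b(4)[OF j]]] .
    qed
    finally show ?thesis .
  qed
  have "HSum C W P (\<lambda>j. \<iota> j \<cdot> (\<pi> j \<cdot> u)) J = HSum C W P (\<lambda>j. \<iota> j \<cdot> (\<pi> j \<cdot> v)) J"
  proof (rule HSum_cong[OF W b(2)])
    fix j assume j: "j \<in> J"
    show "\<iota> j \<cdot> (\<pi> j \<cdot> u) \<in> Hom C W P"
      using Comp_in[OF Comp_in[OF u b(5)[OF j]] b(4)[OF j]] .
    show "\<iota> j \<cdot> (\<pi> j \<cdot> u) = \<iota> j \<cdot> (\<pi> j \<cdot> v)" using eq[OF j] by simp
  qed
  with *[OF u] *[OF v] show ?thesis by simp
qed

lemma biproduct_pr_HSum:
  assumes B: "is_biproduct C J Y P \<iota> \<pi>" and W: "W \<in> Obj C"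
    and c: "\<And>k. k \<in> J \<Longrightarrow> c k \<in> Hom C W (Y k)" and j: "j \<in> J"
  shows "\<pi> j \<cdot> HSum C W P (\<lambda>k. \<iota> k \<cdot> c k) J = c j"
proof -
  note b = is_biproductD[OF B]
  have *: "\<pi> j \<cdot> (\<iota> k \<cdot> c k) = (if j = k then c j else Zero C W (Y j))" if "k \<in> J" for k
    using Comp_assoc[OF c[OF that] b(4)[OF that] b(5)[OF j]] b(6)[OF j that] c[OF that] b(3)[OF j]
    by (auto simp: Hom_iff)
  have "\<pi> j \<cdot> HSum C W P (\<lambda>k. \<iota> k \<cdot> c k) J = HSum C W (Y j) (\<lambda>k. \<pi> j \<cdot> (\<iota> k \<cdot> c k)) J"
    by (rule Comp_HSum[OF b(1) W Comp_in[OF c b(4)] b(5)[OF j]])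
  also have "\<dots> = \<pi> j \<cdot> (\<iota> j \<cdot> c j)"
    by (rule HSum_single[OF W b(3)[OF j] b(1) j]) (use * j c in auto)
  finally show ?thesis using *[OF j] by simp
qed

lemma biproduct_tuple_in:
  assumes B: "is_biproduct C J Y P \<iota> \<pi>" and W: "W \<in> Obj C"
    and c: "\<And>k. k \<in> J \<Longrightarrow> c k \<in> Hom C W (Y k)"
  shows "HSum C W P (\<lambda>k. \<iota> k \<cdot> c k) J \<in> Hom C W P"
  by (rule HSum_in[OF W is_biproductD(2)[OF B] Comp_in[OF c is_biproductD(4)[OF B]]])

lemma kernelD:
  assumes "is_kernel C X Y f K k"
  shows "f \<in> Hom C X Y" "k \<in> Hom C K X" "f \<cdot> k = Zero C K Y"
  using assms by (auto simp: is_kernel_def)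

lemma kernel_lift:
  assumes "is_kernel C X Y f K k" "h \<in> Hom C W X" "f \<cdot> h = Zero C W Y"
  obtains u where "u \<in> Hom C W K" "k \<cdot> u = h"
  using assms Hom_Obj[OF assms(2)] unfolding is_kernel_def by metis

lemma kernel_eqI:
  assumes k: "is_kernel C X Y f K k" and u: "u \<in> Hom C W K" and v: "v \<in> Hom C W K"
    and eq: "k \<cdot> u = k \<cdot> v"
  shows "u = v"
proof -
  note K = kernelD[OF k]
  have "k \<cdot> v \<in> Hom C W X" using Comp_in[OF v K(2)] .
  moreover have "f \<cdot> (k \<cdot> v) = Zero C W Y"
    using Comp_assoc[OF v K(2) K(1)] K v Hom_Obj[OF K(1)] by (auto simp: Hom_iff)
  ultimately have "\<exists>!w. w \<in> Hom C W K \<and> k \<cdot> w = k \<cdot> v"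
    using k Hom_Obj[OF u] unfolding is_kernel_def by blast
  then show ?thesis using u v eq by blast
qed

lemma direct_summand_retract:
  assumes "direct_summand C X P"
  shows "retract X P"
proof -
  from assms obtain Y \<iota> \<pi> where "is_biproduct C {0, 1} (\<lambda>j. if j = 0 then X else Y) P \<iota> \<pi>"
    unfolding direct_summand_def by blast
  note b = is_biproductD[OF this]
  show ?thesis unfolding retract_def using b(4)[of 0] b(5)[of 0] b(6)[of 0 0] by auto
qed

lemma HSum_pair:
  assumes "X \<in> Obj C" "Y \<in> Obj C" "f 0 \<in> Hom C X Y" "f (1::nat) \<in> Hom C X Y"
  shows "HSum C X Y f {0, 1} = f 0 \<boxplus> f 1"
  using HSum_insert[OF assms(1,2), of "{1}" 0 f] HSum_insert[OF assms(1,2), of "{}" 1 f]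
    Add_Zero[OF assms(1,2) assms(4)] assms by auto

end

text \<open>The complement is the kernel \<open>k\<close> of \<open>r\<close>: the morphism
  \<open>d = 1 - i r\<close> is killed by \<open>r\<close>, so it factors as
  \<open>k \<cdot> q\<close>, and \<open>q\<close> is the second projection.\<close>

lemma (in abelian_category) retract_direct_summand:
  assumes "retract X P"
  shows "direct_summand C X P"
proof -
  from assms obtain i r where i: "i \<in> Hom C X P" and r: "r \<in> Hom C P X"
    and ri: "r \<cdot> i = Ident C X"
    unfolding retract_def by blast
  from kernel_exists[OF r] obtain K k where k: "is_kernel C P X r K k" by blast
  note K = kernelD[OF k]
  have O: "X \<in> Obj C" "P \<in> Obj C" "K \<in> Obj C" using Hom_Obj[OF i] Hom_Obj[OF K(2)] by auto
  have ir: "i \<cdot> r \<in> Hom C P P" using Comp_in[OF r i] .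
  have 1: "Ident C P \<in> Hom C P P" using Ident_in O by simp
  obtain d where d: "d \<in> Hom C P P" and ird: "i \<cdot> r \<boxplus> d = Ident C P"
    using diff_exists[OF O(2) O(2) ir 1] .
  have rd: "r \<cdot> d \<in> Hom C P X" using Comp_in[OF d r] .
  \<comment> \<open>Composing \<open>i \<cdot> r \<boxplus> d = 1\<close> with \<open>r\<close> and
    cancelling \<open>r\<close> gives \<open>r \<cdot> d = 0\<close>; the values of
    \<open>d \<cdot> i\<close> and \<open>d \<cdot> k\<close> are found in the same way.\<close>
  have "r \<boxplus> r \<cdot> d = r \<boxplus> Zero C P X"
    using Add_Comp[OF ir d r] ird i r ri arr_assoc[of r i r] Add_Zero[OF O(2) O(1) r]
    by (simp add: Hom_iff)
  then have rd0: "r \<cdot> d = Zero C P X"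
    using Add_cancel[OF O(2) O(1) r rd] O by (simp add: Hom_iff)
  obtain q where q: "q \<in> Hom C P K" and kq: "k \<cdot> q = d"
    using kernel_lift[OF k d rd0] .
  have di: "d \<cdot> i \<in> Hom C X P" using Comp_in[OF i d] .
  have "i \<boxplus> d \<cdot> i = i \<boxplus> Zero C X P"
    using Comp_Add[OF i ir d] ird i r ri arr_assoc[of i r i] Add_Zero[OF O(1) O(2) i]
    by (simp add: Hom_iff)
  then have di0: "d \<cdot> i = Zero C X P"
    using Add_cancel[OF O(1) O(2) i di] O by (simp add: Hom_iff)
  have qi: "q \<cdot> i = Zero C X K"
    by (rule kernel_eqI[OF k Comp_in[OF i q]])
      (use di0 Comp_assoc[OF i q K(2)] kq O K in \<open>auto simp: Hom_iff\<close>)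
  have dk: "d \<cdot> k \<in> Hom C K P" using Comp_in[OF K(2) d] .
  have z: "Zero C K P \<in> Hom C K P" using O by (simp add: Hom_iff)
  have "Zero C K P \<boxplus> d \<cdot> k = Zero C K P \<boxplus> k"
    using Comp_Add[OF K(2) ir d] ird K i r arr_assoc[of k r i] O Zero_Add[OF O(3) O(2) K(2)]
    by (simp add: Hom_iff)
  then have dk: "d \<cdot> k = k" using Add_cancel[OF O(3) O(2) z dk K(2)] by simp
  have qk: "q \<cdot> k = Ident C K"
    by (rule kernel_eqI[OF k Comp_in[OF K(2) q]])
      (use dk Comp_assoc[OF K(2) q K(2)] kq O K in \<open>auto simp: Hom_iff\<close>)
  have "is_biproduct C {0, 1} (\<lambda>j. if j = 0 then X else K) P
    (\<lambda>j. if j = 0 then i else k) (\<lambda>j. if j = 0 then r else q)"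
    unfolding is_biproduct_def
    using HSum_pair[OF O(2) O(2), of "\<lambda>j. (if j = 0 then i else k) \<cdot> (if j = 0 then r else q)"]
      i r ri K q qk qi O ird kq d ir
    by auto
  then show ?thesis unfolding direct_summand_def by blast
qed

text \<open>Being equational, biproducts survive every additive functor. This serves twice: for the
  \<open>G i\<close>, to identify maps into \<open>G i\<close> of a biproduct, and for H, to carry
  summands into the extension.\<close>

lemma additive_functor_biproduct:
  assumes "preadditive_category C" "preadditive_category D" "is_functor C D F" "additive C D F"
    and B: "is_biproduct C J Y P \<iota> \<pi>"
  shows "is_biproduct D J (\<lambda>j. OMap F (Y j)) (OMap F P) (\<lambda>j. AMap F (\<iota> j)) (\<lambda>j. AMap F (\<pi> j))"
proof -
  interpret C: preadditive_category C by fact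
  interpret D: preadditive_category D by fact
  interpret F: is_functor C D F by fact
  note b = C.is_biproductD[OF B]
  have add: "AMap F (f \<boxplus>\<^bsub>C\<^esub> g) = AMap F f \<boxplus>\<^bsub>D\<^esub> AMap F g"
    if "f \<in> Hom C X Z" "g \<in> Hom C X Z" for f g X Z
    using assms(4) that C.Hom_Obj[OF that(1)] unfolding additive_def by blast
  \<comment> \<open>\<open>additive\<close> speaks of sums only. From \<open>0 + 0 = 0\<close> and
    cancellation the functor preserves zero morphisms, which the off-diagonal components
    require.\<close>
  have zero: "AMap F (Zero C X Z) = Zero D (OMap F X) (OMap F Z)" if "X \<in> Obj C" "Z \<in> Obj C" for X Z
  proof -
    have z: "Zero C X Z \<in> Hom C X Z" using that by (simp add: C.Hom_iff)
    have Fz: "AMap F (Zero C X Z) \<in> Hom D (OMap F X) (OMap F Z)" by (rule F.AMap_in[OF z])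
    have O: "OMap F X \<in> Obj D" "OMap F Z \<in> Obj D" using that F.OMap_in by auto
    have "AMap F (Zero C X Z) \<boxplus>\<^bsub>D\<^esub> AMap F (Zero C X Z)
        = AMap F (Zero C X Z) \<boxplus>\<^bsub>D\<^esub> Zero D (OMap F X) (OMap F Z)"
      using add[OF z z] C.Add_Zero[OF that z] D.Add_Zero[OF O Fz] by simp
    then show ?thesis using D.Add_cancel[OF O Fz Fz] O by (simp add: D.Hom_iff)
  qed
  have sum: "AMap F (HSum C X Z f J) = HSum D (OMap F X) (OMap F Z) (\<lambda>j. AMap F (f j)) J"
    if "finite J" "X \<in> Obj C" "Z \<in> Obj C" "\<And>j. j \<in> J \<Longrightarrow> f j \<in> Hom C X Z" for X Z f and J :: "nat set"
    using that(1,4)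
  proof (induction J)
    case empty
    then show ?case using that zero F.OMap_in by (simp)
  next
    case (insert j J)
    have O: "OMap F X \<in> Obj D" "OMap F Z \<in> Obj D" using that F.OMap_in by auto
    have "HSum C X Z f J \<in> Hom C X Z"
      using insert.prems by (intro C.HSum_in[OF that(2,3)]) auto
    then show ?case
      using C.HSum_insert[OF that(2,3) insert.hyps(1,2) insert.prems]
        D.HSum_insert[OF O insert.hyps(1,2) F.AMap_in[OF insert.prems]]
        insert.IH[OF insert.prems[OF insertI2]] add[OF insert.prems[OF insertI1]] by simp
  qed
  have comp: "AMap F (\<pi> j) \<cdot>\<^bsub>D\<^esub> AMap F (\<iota> k) = AMap F (\<pi> j \<cdot>\<^bsub>C\<^esub> \<iota> k)"
    "AMap F (\<iota> k) \<cdot>\<^bsub>D\<^esub> AMap F (\<pi> k) = AMap F (\<iota> k \<cdot>\<^bsub>C\<^esub> \<pi> k)" if "j \<in> J" "k \<in> J" for j k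
    using F.AMap_Comp[OF b(4)[OF that(2)] b(5)[OF that(1)]]
      F.AMap_Comp[OF b(5)[OF that(2)] b(4)[OF that(2)]] by auto
  have O: "OMap F P \<in> Obj D" using F.OMap_in[OF b(2)] .
  have "HSum D (OMap F P) (OMap F P) (\<lambda>j. AMap F (\<iota> j) \<cdot>\<^bsub>D\<^esub> AMap F (\<pi> j)) J
      = HSum D (OMap F P) (OMap F P) (\<lambda>j. AMap F (\<iota> j \<cdot>\<^bsub>C\<^esub> \<pi> j)) J"
    by (rule D.HSum_cong[OF O O])
      (use comp D.Comp_in[OF F.AMap_in[OF b(5)] F.AMap_in[OF b(4)]] in auto)
  also have "\<dots> = AMap F (Ident C P)"
    using sum[OF b(1,2,2), of "\<lambda>j. \<iota> j \<cdot>\<^bsub>C\<^esub> \<pi> j"] C.Comp_in[OF b(5,4)] b(7) by simp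
  finally have "HSum D (OMap F P) (OMap F P) (\<lambda>j. AMap F (\<iota> j) \<cdot>\<^bsub>D\<^esub> AMap F (\<pi> j)) J
      = Ident D (OMap F P)"
    using F.AMap_Ident[OF b(2)] by simp
  then show ?thesis
    unfolding is_biproduct_def
    using b(1) O F.OMap_in[OF b(3)] F.AMap_in[OF b(4)] F.AMap_in[OF b(5)] comp b(6) zero b(3)
      F.AMap_Ident
    by auto
qed

lemma (in category) is_functor_arr:
  assumes "is_functor C D F" "f \<in> Arr C"
  shows "AMap F f \<in> Arr D" "Dom D (AMap F f) = OMap F (Dom C f)" "Cod D (AMap F f) = OMap F (Cod C f)"
  using is_functor.AMap_in[OF assms(1), of f "Dom C f" "Cod C f"] assms(2) by (auto simp: Hom_def)

section \<open>The left trivial extension as a preadditive category\<close>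

locale left_trivial_extension = abelian_category A
  for A :: "('o, 'm, 'x) preadd_cat_scheme" (structure) +
  fixes n :: nat
    and G :: "nat \<Rightarrow> ('o, 'm) endoftor"
    and \<Psi> :: "nat \<Rightarrow> nat \<Rightarrow> 'o \<Rightarrow> 'm"
  assumes G_functor: "i \<in> {1..n} \<Longrightarrow> is_functor A A (G i)"
    and G_additive: "i \<in> {1..n} \<Longrightarrow> additive A A (G i)"
    and G_left_exact: "i \<in> {1..n} \<Longrightarrow> left_exact A A (G i)"
    and Psi_nat_trans: "nat_trans_family A n G \<Psi>"
    and Psi_coassociative: "coassociative A n G \<Psi>"
begin

section \<open>The functors \<open>G k\<close> and the maps \<open>\<Psi>\<close>, extended by the
  index 0\<close>

lemma G_Obj [simp]: "i \<in> {1..n} \<Longrightarrow> X \<in> Obj A \<Longrightarrow> OMap (G i) X \<in> Obj A"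
  using is_functor.OMap_in[OF G_functor] .

lemma G_arr [simp]:
  assumes "i \<in> {1..n}" "f \<in> Arr A"
  shows "AMap (G i) f \<in> Arr A" "Dom A (AMap (G i) f) = OMap (G i) (Dom A f)"
    "Cod A (AMap (G i) f) = OMap (G i) (Cod A f)"
  using is_functor_arr[OF G_functor[OF assms(1)] assms(2)] .

lemma G_Ident [simp]: "i \<in> {1..n} \<Longrightarrow> X \<in> Obj A \<Longrightarrow> AMap (G i) (Ident A X) = Ident A (OMap (G i) X)"
  using is_functor.AMap_Ident[OF G_functor] .

lemma G_Comp [simp]:
  "i \<in> {1..n} \<Longrightarrow> f \<in> Arr A \<Longrightarrow> g \<in> Arr A \<Longrightarrow> Dom A g = Cod A f \<Longrightarrow>
    AMap (G i) (g \<cdot> f) = AMap (G i) g \<cdot> AMap (G i) f"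
  using is_functor.AMap_Comp[OF G_functor, of i f "Dom A f" "Cod A f" g "Cod A g"]
  by (simp add: Hom_iff)

lemma G_Add [simp]:
  "i \<in> {1..n} \<Longrightarrow> f \<in> Arr A \<Longrightarrow> g \<in> Arr A \<Longrightarrow> Dom A g = Dom A f \<Longrightarrow> Cod A g = Cod A f \<Longrightarrow>
    AMap (G i) (f \<boxplus> g) = AMap (G i) f \<boxplus> AMap (G i) g"
  using G_additive[of i] Dom_in[of f] Cod_in[of f] unfolding additive_def by (simp add: Hom_iff)

lemma G_Zero [simp]:
  assumes "i \<in> {1..n}" "X \<in> Obj A" "Y \<in> Obj A"
  shows "AMap (G i) (Zero A X Y) = Zero A (OMap (G i) X) (OMap (G i) Y)"
proof -
  let ?Z = "Zero A X Y" and ?X = "OMap (G i) X" and ?Y = "OMap (G i) Y"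
  have Z: "AMap (G i) ?Z \<in> Hom A ?X ?Y" "Zero A ?X ?Y \<in> Hom A ?X ?Y" "?Z \<in> Hom A X Y"
    using assms by (simp_all add: Hom_iff)
  have O: "?X \<in> Obj A" "?Y \<in> Obj A" using assms by auto
  have "AMap (G i) ?Z \<boxplus> AMap (G i) ?Z = AMap (G i) ?Z \<boxplus> Zero A ?X ?Y"
    using G_Add[of i ?Z ?Z] assms Add_Zero[OF O Z(1)] Add_Zero[OF assms(2,3) Z(3)] by simp
  then show ?thesis using Add_cancel[OF O Z(1) Z(1) Z(2)] by simp
qed

lemma G_biproduct:
  "i \<in> {1..n} \<Longrightarrow> is_biproduct A J Y P \<iota> \<pi> \<Longrightarrow>
    is_biproduct A J (\<lambda>j. OMap (G i) (Y j)) (OMap (G i) P) (\<lambda>j. AMap (G i) (\<iota> j)) (\<lambda>j. AMap (G i) (\<pi> j))"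
  using additive_functor_biproduct[OF preadditive_category_axioms preadditive_category_axioms
      G_functor G_additive] .

lemma Gs_0 [simp]: "OMap (Gs G 0) X = X" "AMap (Gs G 0) f = f"
  and Gs_pos [simp]: "0 < k \<Longrightarrow> Gs G k = G k"
  by (auto simp: Gs_def)

lemma Gs_Obj [simp]: "k \<le> n \<Longrightarrow> X \<in> Obj A \<Longrightarrow> OMap (Gs G k) X \<in> Obj A"
  by (cases "k = 0") auto

lemma Gs_arr [simp]:
  assumes "k \<le> n" "f \<in> Arr A"
  shows "AMap (Gs G k) f \<in> Arr A" "Dom A (AMap (Gs G k) f) = OMap (Gs G k) (Dom A f)"
    "Cod A (AMap (Gs G k) f) = OMap (Gs G k) (Cod A f)"
  using assms by (cases "k = 0"; simp)+

lemma Gs_Comp [simp]: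
  "k \<le> n \<Longrightarrow> f \<in> Arr A \<Longrightarrow> g \<in> Arr A \<Longrightarrow> Dom A g = Cod A f \<Longrightarrow>
    AMap (Gs G k) (g \<cdot> f) = AMap (Gs G k) g \<cdot> AMap (Gs G k) f"
  by (cases "k = 0") auto

text \<open>The counterpart of \<open>Gs\<close>: with \<open>\<Psi> i 0 = id\<close> the identity
  components of the structure maps of H and their \<open>\<Psi>\<close> components obey the same
  formulas. Only the second index is extended, since the first one always belongs to a structure
  map.\<close>

definition Psis :: "nat \<Rightarrow> nat \<Rightarrow> 'o \<Rightarrow> 'm"
  where "Psis i j X = (if j = 0 then Ident A (OMap (G i) X) else \<Psi> i j X)"

lemma Psi_arr:
  assumes "i \<in> {1..n}" "j \<in> {1..n}" "i + j \<le> n" "X \<in> Obj A"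
  shows "\<Psi> i j X \<in> Arr A" "Dom A (\<Psi> i j X) = OMap (G (i + j)) X"
    "Cod A (\<Psi> i j X) = OMap (G i) (OMap (G j) X)"
proof -
  have "i + j \<in> {1..n}" using assms by simp
  then have "\<Psi> i j X \<in> Hom A (OMap (G (i + j)) X) (OMap (G i) (OMap (G j) X))"
    using Psi_nat_trans assms unfolding nat_trans_family_def nat_trans_def fcomp_def by fastforce
  then show "\<Psi> i j X \<in> Arr A" "Dom A (\<Psi> i j X) = OMap (G (i + j)) X"
    "Cod A (\<Psi> i j X) = OMap (G i) (OMap (G j) X)" by (auto simp: Hom_iff)
qed

lemma Psi_natural:
  assumes "i \<in> {1..n}" "j \<in> {1..n}" "i + j \<le> n" "f \<in> Arr A"
  shows "AMap (G i) (AMap (G j) f) \<cdot> \<Psi> i j (Dom A f) = \<Psi> i j (Cod A f) \<cdot> AMap (G (i + j)) f"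
proof -
  have "i + j \<in> {1..n}" using assms by simp
  then have "nat_trans A A (G (i + j)) (fcomp (G i) (G j)) (\<Psi> i j)"
    using Psi_nat_trans assms unfolding nat_trans_family_def by blast
  moreover have "f \<in> Hom A (Dom A f) (Cod A f)" using assms by (simp add: Hom_iff)
  ultimately show ?thesis
    using Dom_in[of f] Cod_in[of f] assms unfolding nat_trans_def fcomp_def by auto
qed

lemma Psis_arr [simp]:
  assumes "i \<in> {1..n}" "i + j \<le> n" "X \<in> Obj A"
  shows "Psis i j X \<in> Arr A" "Dom A (Psis i j X) = OMap (G (i + j)) X"
    "Cod A (Psis i j X) = OMap (G i) (OMap (Gs G j) X)"
  using assms Psi_arr[of i j X] by (auto simp: Psis_def)

lemma Psis_natural:
  assumes "i \<in> {1..n}" "i + j \<le> n" "f \<in> Arr A"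
  shows "AMap (G i) (AMap (Gs G j) f) \<cdot> Psis i j (Dom A f) = Psis i j (Cod A f) \<cdot> AMap (G (i + j)) f"
  using assms Psi_natural[of i j f] Dom_in[of f] Cod_in[of f] by (auto simp: Psis_def)

text \<open>For \<open>l = 0\<close> both sides are \<open>\<Psi> i j X\<close>, so extending by
  identities does not disturb coassociativity.\<close>

lemma Psis_coassoc:
  assumes "i \<in> {1..n}" "j \<in> {1..n}" "i + j + l \<le> n" "X \<in> Obj A"
  shows "AMap (G i) (Psis j l X) \<cdot> Psis i (j + l) X = Psis i j (OMap (Gs G l) X) \<cdot> Psis (i + j) l X"
proof (cases "l = 0")
  case True
  then show ?thesis using assms Psi_arr[of i j X] by (simp add: Psis_def)
next
  case False
  then have "l \<in> {1..n}" "i + j + l \<in> {1..n}" using assms by auto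
  then show ?thesis
    using Psi_coassociative assms False unfolding coassociative_def by (simp add: Psis_def)
qed

section \<open>Comodules, comodule maps and their hom-groups\<close>

abbreviation "T \<equiv> triv_ext A n G \<Psi>"

lemma TObjD:
  assumes "s \<in> TObj A n G \<Psi>"
  shows "fst s \<in> Obj A"
    "i \<in> {1..n} \<Longrightarrow> snd s i \<in> Arr A" "i \<in> {1..n} \<Longrightarrow> Dom A (snd s i) = fst s"
    "i \<in> {1..n} \<Longrightarrow> Cod A (snd s i) = OMap (G i) (fst s)"
  using assms by (auto simp: TObj_def Hom_iff)

lemma TObj_coaction:
  assumes "s \<in> TObj A n G \<Psi>" "i \<in> {1..n}" "j \<in> {1..n}"
  shows "AMap (G i) (snd s j) \<cdot> snd s i =
    (if i + j \<le> n then \<Psi> i j (fst s) \<cdot> snd s (i + j)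
     else Zero A (fst s) (OMap (G i) (OMap (G j) (fst s))))"
  using assms by (auto simp: TObj_def)

lemma TObjI:
  assumes "X \<in> Obj A" "g \<in> extensional {1..n}"
    "\<And>i. i \<in> {1..n} \<Longrightarrow> g i \<in> Hom A X (OMap (G i) X)"
    "\<And>i j. i \<in> {1..n} \<Longrightarrow> j \<in> {1..n} \<Longrightarrow> i + j \<le> n \<Longrightarrow> AMap (G i) (g j) \<cdot> g i = \<Psi> i j X \<cdot> g (i + j)"
    "\<And>i j. i \<in> {1..n} \<Longrightarrow> j \<in> {1..n} \<Longrightarrow> \<not> i + j \<le> n \<Longrightarrow>
      AMap (G i) (g j) \<cdot> g i = Zero A X (OMap (G i) (OMap (G j) X))"
  shows "(X, g) \<in> TObj A n G \<Psi>"
  unfolding TObj_def using assms by simp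

text \<open>An arrow of \<open>T\<close> stripped of its source and target tags, so that equations
  between arrows can be computed in \<open>A\<close>.\<close>

definition comod_hom :: "('o, 'm) text_obj \<Rightarrow> ('o, 'm) text_obj \<Rightarrow> 'm \<Rightarrow> bool"
  where "comod_hom s t \<gamma> \<longleftrightarrow> s \<in> TObj A n G \<Psi> \<and> t \<in> TObj A n G \<Psi> \<and> \<gamma> \<in> Hom A (fst s) (fst t) \<and>
    (\<forall>i\<in>{1..n}. snd t i \<cdot> \<gamma> = AMap (G i) \<gamma> \<cdot> snd s i)"

lemma comod_homD:
  assumes "comod_hom s t \<gamma>"
  shows "s \<in> TObj A n G \<Psi>" "t \<in> TObj A n G \<Psi>" "\<gamma> \<in> Arr A" "Dom A \<gamma> = fst s" "Cod A \<gamma> = fst t"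
    "i \<in> {1..n} \<Longrightarrow> snd t i \<cdot> \<gamma> = AMap (G i) \<gamma> \<cdot> snd s i"
  using assms by (auto simp: comod_hom_def Hom_iff)

lemma comod_hom_Hom: "comod_hom s t \<gamma> \<Longrightarrow> \<gamma> \<in> Hom A (fst s) (fst t)"
  by (simp add: comod_hom_def)

lemma comod_hom_Ident: "s \<in> TObj A n G \<Psi> \<Longrightarrow> comod_hom s s (Ident A (fst s))"
  using TObjD[of s] by (simp add: comod_hom_def Hom_iff)

lemma comod_hom_Comp:
  assumes "comod_hom s t \<gamma>" "comod_hom t r \<delta>"
  shows "comod_hom s r (\<delta> \<cdot> \<gamma>)"
  unfolding comod_hom_def
proof (intro conjI ballI)
  note a = comod_homD[OF assms(1)] and b = comod_homD[OF assms(2)]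
  show "s \<in> TObj A n G \<Psi>" "r \<in> TObj A n G \<Psi>" using a b by auto
  show "\<delta> \<cdot> \<gamma> \<in> Hom A (fst s) (fst r)" using a b by (simp add: Hom_iff)
  fix i assume i: "i \<in> {1..n}"
  note o = TObjD[OF a(1)] TObjD[OF a(2)] TObjD[OF b(2)]
  have "snd r i \<cdot> (\<delta> \<cdot> \<gamma>) = (snd r i \<cdot> \<delta>) \<cdot> \<gamma>" using a(1-5) b(1-5) o i by simp
  also have "\<dots> = (AMap (G i) \<delta> \<cdot> snd t i) \<cdot> \<gamma>" using b(6)[OF i] by simp
  also have "\<dots> = AMap (G i) \<delta> \<cdot> (snd t i \<cdot> \<gamma>)" using a(1-5) b(1-5) o i by simp
  also have "\<dots> = AMap (G i) (\<delta> \<cdot> \<gamma>) \<cdot> snd s i" using a(1-5) a(6)[OF i] b o i by simp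
  finally show "snd r i \<cdot> (\<delta> \<cdot> \<gamma>) = AMap (G i) (\<delta> \<cdot> \<gamma>) \<cdot> snd s i" .
qed

lemma arr_Comp_Add:
  "f \<in> Arr A \<Longrightarrow> g \<in> Arr A \<Longrightarrow> h \<in> Arr A \<Longrightarrow> Dom A g = Cod A f \<Longrightarrow> Dom A h = Cod A f \<Longrightarrow>
    Cod A g = Cod A h \<Longrightarrow> (g \<boxplus> h) \<cdot> f = g \<cdot> f \<boxplus> h \<cdot> f"
  using Comp_Add[of f "Dom A f" "Cod A f" g "Cod A g" h] by (simp add: Hom_iff)

lemma arr_Add_Comp:
  "f \<in> Arr A \<Longrightarrow> g \<in> Arr A \<Longrightarrow> h \<in> Arr A \<Longrightarrow> Cod A f = Dom A h \<Longrightarrow> Cod A g = Dom A h \<Longrightarrow>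
    Dom A f = Dom A g \<Longrightarrow> h \<cdot> (f \<boxplus> g) = h \<cdot> f \<boxplus> h \<cdot> g"
  using Add_Comp[of f "Dom A f" "Dom A h" g h "Cod A h"] by (simp add: Hom_iff)

lemma comod_hom_Zero:
  assumes "s \<in> TObj A n G \<Psi>" "t \<in> TObj A n G \<Psi>"
  shows "comod_hom s t (Zero A (fst s) (fst t))"
  using TObjD[OF assms(1)] TObjD[OF assms(2)] assms by (simp add: comod_hom_def Hom_iff)

lemma comod_hom_Add:
  assumes "comod_hom s t \<gamma>" "comod_hom s t \<delta>"
  shows "comod_hom s t (\<gamma> \<boxplus> \<delta>)"
  unfolding comod_hom_def
proof (intro conjI ballI)
  note a = comod_homD[OF assms(1)] and b = comod_homD[OF assms(2)]
  show "s \<in> TObj A n G \<Psi>" "t \<in> TObj A n G \<Psi>" using a b by auto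
  show "\<gamma> \<boxplus> \<delta> \<in> Hom A (fst s) (fst t)" using a b by (simp add: Hom_iff)
  fix i assume i: "i \<in> {1..n}"
  note o = TObjD[OF a(1)] TObjD[OF a(2)]
  show "snd t i \<cdot> (\<gamma> \<boxplus> \<delta>) = AMap (G i) (\<gamma> \<boxplus> \<delta>) \<cdot> snd s i"
    using a(1-5) b(1-5) a(6)[OF i] b(6)[OF i] o i by (simp add: arr_Comp_Add arr_Add_Comp)
qed

text \<open>The comodule condition for \<open>\<delta>\<close> follows by cancelling that for
  \<open>\<gamma>\<close> from that for the sum. This provides inverses in the hom-groups of
  \<open>T\<close> and later makes \<open>v - u v + 1\<close> a comodule map.\<close>

lemma comod_hom_diff:
  assumes "comod_hom s t \<gamma>" "comod_hom s t \<epsilon>" "\<delta> \<in> Hom A (fst s) (fst t)" "\<gamma> \<boxplus> \<delta> = \<epsilon>"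
  shows "comod_hom s t \<delta>"
  unfolding comod_hom_def
proof (intro conjI ballI)
  note a = comod_homD[OF assms(1)] and b = comod_homD[OF assms(2)]
  show "s \<in> TObj A n G \<Psi>" "t \<in> TObj A n G \<Psi>" "\<delta> \<in> Hom A (fst s) (fst t)" using a assms by auto
  fix i assume i: "i \<in> {1..n}"
  note o = TObjD[OF a(1)] TObjD[OF a(2)]
  have d: "\<delta> \<in> Arr A" "Dom A \<delta> = fst s" "Cod A \<delta> = fst t" using assms(3) by (auto simp: Hom_iff)
  have "snd t i \<cdot> \<gamma> \<boxplus> snd t i \<cdot> \<delta> = snd t i \<cdot> (\<gamma> \<boxplus> \<delta>)"
    using a d o i by (simp add: arr_Add_Comp)
  also have "\<dots> = AMap (G i) (\<gamma> \<boxplus> \<delta>) \<cdot> snd s i"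
    using b(6)[OF i] assms(4) by simp
  also have "\<dots> = snd t i \<cdot> \<gamma> \<boxplus> AMap (G i) \<delta> \<cdot> snd s i"
    using a(1-5) a(6)[OF i] d o i by (simp add: arr_Comp_Add)
  finally have eq: "snd t i \<cdot> \<gamma> \<boxplus> snd t i \<cdot> \<delta> = snd t i \<cdot> \<gamma> \<boxplus> AMap (G i) \<delta> \<cdot> snd s i" .
  show "snd t i \<cdot> \<delta> = AMap (G i) \<delta> \<cdot> snd s i"
    by (rule Add_cancel[OF _ _ _ _ _ eq, of "fst s" "OMap (G i) (fst t)"])
      (use a(1-5) d o i in \<open>simp_all add: Hom_iff\<close>)
qed

lemma T_simps [simp]:
  "Obj T = TObj A n G \<Psi>" "Ident T s = (s, s, Ident A (fst s))"
  "(s', t', \<gamma>') \<cdot>\<^bsub>T\<^esub> (s, t, \<gamma>) = (s, t', \<gamma>' \<cdot> \<gamma>)"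
  "(s', t', \<gamma>') \<boxplus>\<^bsub>T\<^esub> (s, t, \<gamma>) = (s, t, \<gamma>' \<boxplus> \<gamma>)"
  "Zero T s t = (s, t, Zero A (fst s) (fst t))"
  "Dom T (s, t, \<gamma>) = s" "Cod T (s, t, \<gamma>) = t"
  "(s, t, \<gamma>) \<in> Arr T \<longleftrightarrow> comod_hom s t \<gamma>"
  by (auto simp: triv_ext_def TArr_def comod_hom_def)

lemma T_Hom_iff: "\<phi> \<in> Hom T s t \<longleftrightarrow> (\<exists>\<gamma>. \<phi> = (s, t, \<gamma>) \<and> comod_hom s t \<gamma>)"
  by (cases \<phi>) (auto simp: Hom_def)

lemma T_preadditive: "preadditive_category T"
proof (intro preadditive_category.intro category.intro preadditive_category_axioms.intro)
  show "Dom T f \<in> Obj T" "Cod T f \<in> Obj T" if "f \<in> Arr T" for f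
    using that by (cases f; auto dest: comod_homD)+
  show "Ident T s \<in> Hom T s s" if "s \<in> Obj T" for s
    using that comod_hom_Ident by (simp add: T_Hom_iff)
  show "g \<cdot>\<^bsub>T\<^esub> f \<in> Hom T s r" if "f \<in> Hom T s t" "g \<in> Hom T t r" for f g s t r
    using that by (auto simp: T_Hom_iff intro: comod_hom_Comp)
  show "f \<cdot>\<^bsub>T\<^esub> Ident T s = f" "Ident T t \<cdot>\<^bsub>T\<^esub> f = f" if "f \<in> Hom T s t" for f s t
    using that by (auto simp: T_Hom_iff intro: Comp_Ident[OF comod_hom_Hom] Ident_Comp[OF comod_hom_Hom])
  show "(h \<cdot>\<^bsub>T\<^esub> g) \<cdot>\<^bsub>T\<^esub> f = h \<cdot>\<^bsub>T\<^esub> g \<cdot>\<^bsub>T\<^esub> f"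
    if "f \<in> Hom T s t" "g \<in> Hom T t r" "h \<in> Hom T r q" for f g h s t r q
    using that by (auto simp: T_Hom_iff dest!: comod_hom_Hom intro: Comp_assoc)
  show "(g \<boxplus>\<^bsub>T\<^esub> h) \<cdot>\<^bsub>T\<^esub> f = g \<cdot>\<^bsub>T\<^esub> f \<boxplus>\<^bsub>T\<^esub> h \<cdot>\<^bsub>T\<^esub> f"
    if "f \<in> Hom T s t" "g \<in> Hom T t r" "h \<in> Hom T t r" for f g h s t r
    using that by (auto simp: T_Hom_iff dest!: comod_hom_Hom intro: Comp_Add)
  show "h \<cdot>\<^bsub>T\<^esub> (f \<boxplus>\<^bsub>T\<^esub> g) = h \<cdot>\<^bsub>T\<^esub> f \<boxplus>\<^bsub>T\<^esub> h \<cdot>\<^bsub>T\<^esub> g"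
    if "f \<in> Hom T s t" "g \<in> Hom T s t" "h \<in> Hom T t r" for f g h s t r
    using that by (auto simp: T_Hom_iff dest!: comod_hom_Hom intro: Add_Comp)
  show "comm_group (HomGrp T s t)" if "s \<in> Obj T" "t \<in> Obj T" for s t
  proof (rule comm_groupI)
    have st: "s \<in> TObj A n G \<Psi>" "t \<in> TObj A n G \<Psi>" using that by auto
    note O = TObjD(1)[OF st(1)] TObjD(1)[OF st(2)]
    note defs = HomGrp_def T_Hom_iff
    show "\<one>\<^bsub>HomGrp T s t\<^esub> \<in> carrier (HomGrp T s t)"
      using comod_hom_Zero[OF st] by (simp add: defs)
    fix x assume "x \<in> carrier (HomGrp T s t)"
    then obtain \<alpha> where x: "x = (s, t, \<alpha>)" "comod_hom s t \<alpha>" by (auto simp: defs)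
    note xh = comod_hom_Hom[OF x(2)]
    show "\<one>\<^bsub>HomGrp T s t\<^esub> \<otimes>\<^bsub>HomGrp T s t\<^esub> x = x"
      using x Zero_Add[OF O xh] by (simp add: defs)
    show "\<exists>y\<in>carrier (HomGrp T s t). y \<otimes>\<^bsub>HomGrp T s t\<^esub> x = \<one>\<^bsub>HomGrp T s t\<^esub>"
    proof -
      obtain d where d: "d \<in> Hom A (fst s) (fst t)" "\<alpha> \<boxplus> d = Zero A (fst s) (fst t)"
        using diff_exists[OF O xh comod_hom_Hom[OF comod_hom_Zero[OF st]]] .
      have "comod_hom s t d" using comod_hom_diff[OF x(2) comod_hom_Zero[OF st] d] .
      then have "(s, t, d) \<in> carrier (HomGrp T s t)" by (simp add: defs)
      moreover have "(s, t, d) \<otimes>\<^bsub>HomGrp T s t\<^esub> x = \<one>\<^bsub>HomGrp T s t\<^esub>"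
        using x d Add_comm[OF O xh d(1)] by (simp add: defs)
      ultimately show ?thesis by blast
    qed
    fix y assume "y \<in> carrier (HomGrp T s t)"
    then obtain \<beta> where y: "y = (s, t, \<beta>)" "comod_hom s t \<beta>" by (auto simp: defs)
    note yh = comod_hom_Hom[OF y(2)]
    show "x \<otimes>\<^bsub>HomGrp T s t\<^esub> y \<in> carrier (HomGrp T s t)"
      using x y comod_hom_Add by (simp add: defs)
    show "x \<otimes>\<^bsub>HomGrp T s t\<^esub> y = y \<otimes>\<^bsub>HomGrp T s t\<^esub> x"
      using x y Add_comm[OF O xh yh] by (simp add: defs)
    fix z assume "z \<in> carrier (HomGrp T s t)"
    then obtain \<gamma> where z: "z = (s, t, \<gamma>)" "comod_hom s t \<gamma>" by (auto simp: defs)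
    show "x \<otimes>\<^bsub>HomGrp T s t\<^esub> y \<otimes>\<^bsub>HomGrp T s t\<^esub> z = x \<otimes>\<^bsub>HomGrp T s t\<^esub> (y \<otimes>\<^bsub>HomGrp T s t\<^esub> z)"
      using x y z Add_assoc[OF O xh yh comod_hom_Hom[OF z(2)]] by (simp add: defs)
  qed
qed

lemma comod_isomorphicI:
  assumes "comod_hom s t \<gamma>" "comod_hom t s \<delta>" "\<delta> \<cdot> \<gamma> = Ident A (fst s)" "\<gamma> \<cdot> \<delta> = Ident A (fst t)"
  shows "isomorphic T s t"
proof -
  interpret T: preadditive_category T by (rule T_preadditive)
  show ?thesis
    by (rule T.isomorphicI[of "(s, t, \<gamma>)" _ _ "(t, s, \<delta>)"]) (use assms in \<open>simp_all add: T_Hom_iff\<close>)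
qed

end

section \<open>The chosen biproducts and kernels\<close>

context abelian_category
begin

lemma biprod_is_biproduct:
  assumes "finite J" "\<And>j. j \<in> J \<Longrightarrow> Y j \<in> Obj C"
  shows "is_biproduct C J Y (biprod_ob C J Y) (biprod_in C J Y) (biprod_pr C J Y)"
proof -
  obtain P \<iota> \<pi> where "is_biproduct C J Y P \<iota> \<pi>" using biproduct_exists[OF assms(1), of Y] assms(2) by blast
  then have "case (P, \<iota>, \<pi>) of (P, \<iota>, \<pi>) \<Rightarrow> is_biproduct C J Y P \<iota> \<pi>" by simp
  from someI[of "\<lambda>(P, \<iota>, \<pi>). is_biproduct C J Y P \<iota> \<pi>", OF this]
  show ?thesis by (simp add: biprod_def split_beta)
qed

lemma ker_is_kernel:
  assumes "f \<in> Hom C X Y"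
  shows "is_kernel C X Y f (fst (ker C X Y f)) (snd (ker C X Y f))"
proof -
  obtain K k where "is_kernel C X Y f K k" using kernel_exists[OF assms] by blast
  then have "case (K, k) of (K, k) \<Rightarrow> is_kernel C X Y f K k" by simp
  from someI[of "\<lambda>(K, k). is_kernel C X Y f K k", OF this]
  show ?thesis by (simp add: ker_def split_beta)
qed

end

section \<open>Cofree comodules\<close>

context left_trivial_extension
begin

abbreviation "GS \<equiv> Gsum A n G"
abbreviation "incl \<equiv> Gin A n G"
abbreviation "pr \<equiv> Gpr A n G"
abbreviation "lam \<equiv> Hstr A n G \<Psi>"
abbreviation "HO \<equiv> Hob A n G \<Psi>"

lemma GS_biproduct:
  "Y \<in> Obj A \<Longrightarrow> is_biproduct A {0..n} (\<lambda>k. OMap (Gs G k) Y) (GS Y) (incl Y) (pr Y)"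
  by (rule biprod_is_biproduct) auto

lemma GS_Obj [simp]: "Y \<in> Obj A \<Longrightarrow> GS Y \<in> Obj A"
  using is_biproductD(2)[OF GS_biproduct] .

lemma pr_arr [simp]:
  assumes "Y \<in> Obj A" "k \<le> n"
  shows "pr Y k \<in> Arr A" "Dom A (pr Y k) = GS Y" "Cod A (pr Y k) = OMap (Gs G k) Y"
  using is_biproductD(5)[OF GS_biproduct[OF assms(1)], of k] assms(2) by (auto simp: Hom_iff)

lemma incl_arr [simp]:
  assumes "Y \<in> Obj A" "k \<le> n"
  shows "incl Y k \<in> Arr A" "Dom A (incl Y k) = OMap (Gs G k) Y" "Cod A (incl Y k) = GS Y"
  using is_biproductD(4)[OF GS_biproduct[OF assms(1)], of k] assms(2) by (auto simp: Hom_iff)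

lemma GS_eqI:
  assumes "Y \<in> Obj A" "u \<in> Hom A W (GS Y)" "v \<in> Hom A W (GS Y)"
    "\<And>k. k \<le> n \<Longrightarrow> pr Y k \<cdot> u = pr Y k \<cdot> v"
  shows "u = v"
  using biproduct_eqI[OF GS_biproduct[OF assms(1)] assms(2,3)] assms(4) by simp

text \<open>Since \<open>G i\<close> is additive, it turns the biproduct \<open>GS Y\<close> into a
  biproduct, whose projections are the images of the \<open>pr Y k\<close>.\<close>

lemma G_GS_eqI:
  assumes "i \<in> {1..n}" "Y \<in> Obj A" "u \<in> Hom A W (OMap (G i) (GS Y))" "v \<in> Hom A W (OMap (G i) (GS Y))"
    "\<And>k. k \<le> n \<Longrightarrow> AMap (G i) (pr Y k) \<cdot> u = AMap (G i) (pr Y k) \<cdot> v"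
  shows "u = v"
  using biproduct_eqI[OF G_biproduct[OF assms(1) GS_biproduct[OF assms(2)]] assms(3,4)] assms(5)
  by simp

text \<open>Through \<open>Psis\<close>, the identity and the \<open>\<Psi>\<close> components merge
  into the single case \<open>k = i + l\<close>.\<close>

lemma Hcomp_eq:
  assumes "i \<in> {1..n}" "Y \<in> Obj A"
  shows "Hcomp A G \<Psi> Y i k l =
    (if k = i + l then Psis i l Y else Zero A (OMap (Gs G k) Y) (OMap (G i) (OMap (Gs G l) Y)))"
  using assms by (auto simp: Hcomp_def Psis_def)

lemma Hcomp_arr:
  assumes "i \<in> {1..n}" "Y \<in> Obj A" "k \<le> n" "l \<le> n"
  shows "Hcomp A G \<Psi> Y i k l \<in> Arr A" "Dom A (Hcomp A G \<Psi> Y i k l) = OMap (Gs G k) Y"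
    "Cod A (Hcomp A G \<Psi> Y i k l) = OMap (G i) (OMap (Gs G l) Y)"
  using assms by (auto simp: Hcomp_eq)

lemma lam_eq:
  assumes "i \<in> {1..n}"
  shows "lam Y i = HSum A (GS Y) (OMap (G i) (GS Y))
      (\<lambda>(k, j). AMap (G i) (incl Y j) \<cdot> Hcomp A G \<Psi> Y i k j \<cdot> pr Y k) ({0..n} \<times> {0..n})"
  using assms unfolding Hstr_def by (rule restrict_apply')

lemma lam_summand:
  assumes "i \<in> {1..n}" "Y \<in> Obj A" "x \<in> {0..n} \<times> {0..n}"
  shows "(case x of (k, j) \<Rightarrow> AMap (G i) (incl Y j) \<cdot> Hcomp A G \<Psi> Y i k j \<cdot> pr Y k)
    \<in> Hom A (GS Y) (OMap (G i) (GS Y))"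
  using assms Hcomp_arr[OF assms(1,2)] by (auto simp: Hom_iff)

lemma lam_arr [simp]:
  assumes "i \<in> {1..n}" "Y \<in> Obj A"
  shows "lam Y i \<in> Arr A" "Dom A (lam Y i) = GS Y" "Cod A (lam Y i) = OMap (G i) (GS Y)"
  using HSum_in[OF _ _ lam_summand[OF assms], of "{0..n} \<times> {0..n}"] assms lam_eq[OF assms(1), of Y]
  by (auto simp: Hom_iff)

text \<open>Row \<open>j\<close> of the matrix of \<open>lam Y i\<close> has at most one nonzero
  entry, in column \<open>i + j\<close>, and this column exists only for
  \<open>i + j \<le> n\<close>. Computations with \<open>lam\<close> below go through this formula
  instead of the double sum.\<close>

lemma G_pr_lam:
  assumes i: "i \<in> {1..n}" and Y: "Y \<in> Obj A" and j: "j \<le> n"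
  shows "AMap (G i) (pr Y j) \<cdot> lam Y i = (if i + j \<le> n then Psis i j Y \<cdot> pr Y (i + j)
    else Zero A (GS Y) (OMap (G i) (OMap (Gs G j) Y)))"
proof -
  let ?f = "\<lambda>x. case x of (k, l) \<Rightarrow> AMap (G i) (incl Y l) \<cdot> Hcomp A G \<Psi> Y i k l \<cdot> pr Y k"
  let ?g = "\<lambda>x. AMap (G i) (pr Y j) \<cdot> ?f x"
  let ?I = "{0..n} \<times> {0..n}" and ?V = "OMap (G i) (OMap (Gs G j) Y)"
  have V: "GS Y \<in> Obj A" "?V \<in> Obj A" using assms by auto
  have p: "AMap (G i) (pr Y j) \<in> Hom A (OMap (G i) (GS Y)) ?V" using assms by (simp add: Hom_iff)
  have g: "?g (k, l) = (if l = j \<and> k = i + j then Psis i j Y \<cdot> pr Y (i + j) else Zero A (GS Y) ?V)"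
    if kl: "k \<le> n" "l \<le> n" for k l
  proof -
    have "?g (k, l) = AMap (G i) (pr Y j \<cdot> incl Y l) \<cdot> (Hcomp A G \<Psi> Y i k l \<cdot> pr Y k)"
      using assms kl Hcomp_arr[OF i Y kl] by simp
    also have "pr Y j \<cdot> incl Y l =
        (if j = l then Ident A (OMap (Gs G j) Y) else Zero A (OMap (Gs G l) Y) (OMap (Gs G j) Y))"
      using is_biproductD(6)[OF GS_biproduct[OF Y], of j l] j kl by simp
    finally show ?thesis
      using assms kl Hcomp_arr[OF i Y kl] Hcomp_eq[OF i Y, of k l] by auto
  qed
  have "AMap (G i) (pr Y j) \<cdot> lam Y i = HSum A (GS Y) ?V ?g ?I"
    unfolding lam_eq[OF i] by (rule Comp_HSum[OF _ V(1) lam_summand[OF i Y] p]) auto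
  also have "\<dots> = (if i + j \<le> n then Psis i j Y \<cdot> pr Y (i + j) else Zero A (GS Y) ?V)"
  proof (cases "i + j \<le> n")
    case True
    have "HSum A (GS Y) ?V ?g ?I = ?g (i + j, j)"
    proof (rule HSum_single[OF V])
      show "?g (i + j, j) \<in> Hom A (GS Y) ?V"
        using g[OF True j] assms True by (simp add: Hom_iff)
      show "?g x = Zero A (GS Y) ?V" if "x \<in> ?I" "x \<noteq> (i + j, j)" for x
        using that g[of "fst x" "snd x"] by (cases x) auto
    qed (use True j in auto)
    then show ?thesis using g[OF True j] True by simp
  next
    case False
    have "HSum A (GS Y) ?V ?g ?I = Zero A (GS Y) ?V"
    proof (rule HSum_Zero[OF V])
      fix x assume "x \<in> ?I"
      then show "?g x = Zero A (GS Y) ?V" using g[of "fst x" "snd x"] False by (cases x) auto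
    qed
    then show ?thesis using False by simp
  qed
  finally show ?thesis .
qed

lemma Hob_simps [simp]: "fst (HO Y) = GS Y" "snd (HO Y) = lam Y"
  by (auto simp: Hob_def)

text \<open>Both sides of the coaction law are compared after \<open>G i\<close> of
  \<open>G j\<close> of each projection \<open>pr Y l\<close>. They become composites of two
  \<open>\<Psi>\<close> maps with \<open>pr Y (i + j + l)\<close>, which agree by coassociativity
  and naturality; for \<open>i + j + l > n\<close> everything vanishes, in particular whenever
  \<open>i + j > n\<close>.\<close>

lemma Hob_TObj [simp]:
  assumes Y: "Y \<in> Obj A"
  shows "HO Y \<in> TObj A n G \<Psi>"
  unfolding Hob_def
proof (rule TObjI)
  show "GS Y \<in> Obj A" using Y by simp
  show "lam Y \<in> extensional {1..n}" by (simp add: Hstr_def)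
  show "lam Y i \<in> Hom A (GS Y) (OMap (G i) (GS Y))" if "i \<in> {1..n}" for i
    using that Y by (simp add: Hom_iff)
  have pr2: "AMap (G i) (AMap (G j) (pr Y l)) \<cdot> (AMap (G i) (lam Y j) \<cdot> lam Y i) =
      (if i + j + l \<le> n then Psis i j (OMap (Gs G l) Y) \<cdot> (Psis (i + j) l Y \<cdot> pr Y (i + j + l))
       else Zero A (GS Y) (OMap (G i) (OMap (G j) (OMap (Gs G l) Y))))"
    if i: "i \<in> {1..n}" and j: "j \<in> {1..n}" and l: "l \<le> n" for i j l
  proof -
    have "AMap (G i) (AMap (G j) (pr Y l)) \<cdot> (AMap (G i) (lam Y j) \<cdot> lam Y i) =
        AMap (G i) (AMap (G j) (pr Y l) \<cdot> lam Y j) \<cdot> lam Y i"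
      using that Y by simp
    also have "\<dots> = (if i + j + l \<le> n then Psis i j (OMap (Gs G l) Y) \<cdot> (Psis (i + j) l Y \<cdot> pr Y (i + j + l))
       else Zero A (GS Y) (OMap (G i) (OMap (G j) (OMap (Gs G l) Y))))"
    proof (cases "j + l \<le> n")
      case True
      have jl: "j + l \<in> {1..n}" using True j by simp
      have "AMap (G i) (AMap (G j) (pr Y l) \<cdot> lam Y j) \<cdot> lam Y i =
          AMap (G i) (Psis j l Y) \<cdot> (AMap (G i) (pr Y (j + l)) \<cdot> lam Y i)"
        using G_pr_lam[OF j Y l] True i j l Y by simp
      also have "\<dots> = (if i + j + l \<le> n then AMap (G i) (Psis j l Y) \<cdot> (Psis i (j + l) Y \<cdot> pr Y (i + j + l))
          else Zero A (GS Y) (OMap (G i) (OMap (G j) (OMap (Gs G l) Y))))"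
        using G_pr_lam[OF i Y True] i j l Y True by (simp add: add.assoc)
      also have "\<dots> = (if i + j + l \<le> n then Psis i j (OMap (Gs G l) Y) \<cdot> (Psis (i + j) l Y \<cdot> pr Y (i + j + l))
          else Zero A (GS Y) (OMap (G i) (OMap (G j) (OMap (Gs G l) Y))))"
      proof (rule if_cong[OF refl _ refl])
        assume ijl: "i + j + l \<le> n"
        have a: "Psis i (j + l) Y \<in> Arr A" "Dom A (Psis i (j + l) Y) = OMap (G (i + j + l)) Y"
          "Cod A (Psis i (j + l) Y) = OMap (G i) (OMap (G (j + l)) Y)"
          using Psis_arr[OF i _ Y, of "j + l"] ijl j by (simp_all add: add.assoc)
        have b: "Psis (i + j) l Y \<in> Arr A" "Dom A (Psis (i + j) l Y) = OMap (G (i + j + l)) Y"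
          "Cod A (Psis (i + j) l Y) = OMap (G (i + j)) (OMap (Gs G l) Y)"
          using Psis_arr[OF _ ijl Y] ijl i by simp_all
        have "AMap (G i) (Psis j l Y) \<cdot> (Psis i (j + l) Y \<cdot> pr Y (i + j + l)) =
          (AMap (G i) (Psis j l Y) \<cdot> Psis i (j + l) Y) \<cdot> pr Y (i + j + l)"
          using i j Y True ijl l a by simp
        also have "\<dots> = (Psis i j (OMap (Gs G l) Y) \<cdot> Psis (i + j) l Y) \<cdot> pr Y (i + j + l)"
          using Psis_coassoc[OF i j ijl Y] by simp
        also have "\<dots> = Psis i j (OMap (Gs G l) Y) \<cdot> (Psis (i + j) l Y \<cdot> pr Y (i + j + l))"
          using i j Y True ijl l b by simp
        finally show "AMap (G i) (Psis j l Y) \<cdot> (Psis i (j + l) Y \<cdot> pr Y (i + j + l)) =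
          Psis i j (OMap (Gs G l) Y) \<cdot> (Psis (i + j) l Y \<cdot> pr Y (i + j + l))" .
      qed
      finally show ?thesis .
    next
      \<comment> \<open>From \<open>j + l > n\<close> follows \<open>i + j + l > n\<close>: the
        inner composite is zero, and so is the claimed value.\<close>
      case False
      then show ?thesis using G_pr_lam[OF j Y l] i j l Y by simp
    qed
    finally show ?thesis .
  qed
  have eqI: "u = v"
    if i: "i \<in> {1..n}" and j: "j \<in> {1..n}"
      and u: "u \<in> Hom A (GS Y) (OMap (G i) (OMap (G j) (GS Y)))"
      and v: "v \<in> Hom A (GS Y) (OMap (G i) (OMap (G j) (GS Y)))"
      and eq: "\<And>l. l \<le> n \<Longrightarrow> AMap (G i) (AMap (G j) (pr Y l)) \<cdot> u = AMap (G i) (AMap (G j) (pr Y l)) \<cdot> v"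
    for u v i j
    using biproduct_eqI[OF G_biproduct[OF i G_biproduct[OF j GS_biproduct[OF Y]]] u v] eq by simp
  fix i j assume i: "i \<in> {1..n}" and j: "j \<in> {1..n}"
  show "AMap (G i) (lam Y j) \<cdot> lam Y i = \<Psi> i j (GS Y) \<cdot> lam Y (i + j)" if ij: "i + j \<le> n"
  proof (rule eqI[OF i j])
    have ij': "i + j \<in> {1..n}" using i ij by simp
    note P = Psi_arr[OF i j ij, of "GS Y"]
    show "AMap (G i) (lam Y j) \<cdot> lam Y i \<in> Hom A (GS Y) (OMap (G i) (OMap (G j) (GS Y)))"
      using i j Y by (simp add: Hom_iff)
    show "\<Psi> i j (GS Y) \<cdot> lam Y (i + j) \<in> Hom A (GS Y) (OMap (G i) (OMap (G j) (GS Y)))"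
      using P ij' Y by (simp add: Hom_iff)
    fix l assume l: "l \<le> n"
    have Ps: "Psis i j = \<Psi> i j" using j by (auto simp: Psis_def)
    have "AMap (G i) (AMap (G j) (pr Y l)) \<cdot> (\<Psi> i j (GS Y) \<cdot> lam Y (i + j)) =
        (AMap (G i) (AMap (G j) (pr Y l)) \<cdot> \<Psi> i j (GS Y)) \<cdot> lam Y (i + j)"
      using i j l Y P ij' by simp
    also have "\<dots> = (\<Psi> i j (OMap (Gs G l) Y) \<cdot> AMap (G (i + j)) (pr Y l)) \<cdot> lam Y (i + j)"
      using Psi_natural[OF i j ij, of "pr Y l"] l Y by simp
    also have "\<dots> = \<Psi> i j (OMap (Gs G l) Y) \<cdot> (AMap (G (i + j)) (pr Y l) \<cdot> lam Y (i + j))"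
      using i j l Y Psi_arr[OF i j ij, of "OMap (Gs G l) Y"] ij' by simp
    also have "\<dots> = AMap (G i) (AMap (G j) (pr Y l)) \<cdot> (AMap (G i) (lam Y j) \<cdot> lam Y i)"
      unfolding pr2[OF i j l] G_pr_lam[OF ij' Y l] Ps
      using Psi_arr[OF i j ij, of "OMap (Gs G l) Y"] l Y i j ij'
      by (simp add: Comp_Zero[of "\<Psi> i j (OMap (Gs G l) Y)"] del: Gs_pos)
    finally show "AMap (G i) (AMap (G j) (pr Y l)) \<cdot> (AMap (G i) (lam Y j) \<cdot> lam Y i) =
        AMap (G i) (AMap (G j) (pr Y l)) \<cdot> (\<Psi> i j (GS Y) \<cdot> lam Y (i + j))" by simp
  qed
  show "AMap (G i) (lam Y j) \<cdot> lam Y i = Zero A (GS Y) (OMap (G i) (OMap (G j) (GS Y)))"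
    if ij: "\<not> i + j \<le> n"
  proof (rule eqI[OF i j])
    show "AMap (G i) (lam Y j) \<cdot> lam Y i \<in> Hom A (GS Y) (OMap (G i) (OMap (G j) (GS Y)))"
      "Zero A (GS Y) (OMap (G i) (OMap (G j) (GS Y))) \<in> Hom A (GS Y) (OMap (G i) (OMap (G j) (GS Y)))"
      using i j Y by (simp_all add: Hom_iff)
    fix l assume l: "l \<le> n"
    show "AMap (G i) (AMap (G j) (pr Y l)) \<cdot> (AMap (G i) (lam Y j) \<cdot> lam Y i) =
      AMap (G i) (AMap (G j) (pr Y l)) \<cdot> Zero A (GS Y) (OMap (G i) (OMap (G j) (GS Y)))"
      unfolding pr2[OF i j l] using ij i j l Y by simp
  qed
qed

section \<open>The universal property of H Y\<close>

text \<open>The structure maps extended by \<open>g\<^sub>0 = id\<close>, and likewise \<open>\<Psi>\<^bsub>i,0\<^esub> = id\<close> in \<open>Psis\<close>: the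
  coaction law then also holds for \<open>j = 0\<close>.\<close>

definition coact :: "('o, 'm) text_obj \<Rightarrow> nat \<Rightarrow> 'm"
  where "coact s k = (if k = 0 then Ident A (fst s) else snd s k)"

lemma coact_arr [simp]:
  assumes "s \<in> TObj A n G \<Psi>" "k \<le> n"
  shows "coact s k \<in> Arr A" "Dom A (coact s k) = fst s" "Cod A (coact s k) = OMap (Gs G k) (fst s)"
  using TObjD[OF assms(1)] assms(2) by (auto simp: coact_def)

lemma coact_coaction:
  assumes "s \<in> TObj A n G \<Psi>" "i \<in> {1..n}" "j \<le> n"
  shows "AMap (G i) (coact s j) \<cdot> snd s i =
    (if i + j \<le> n then Psis i j (fst s) \<cdot> snd s (i + j)
     else Zero A (fst s) (OMap (G i) (OMap (Gs G j) (fst s))))"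
  using TObjD[OF assms(1)] TObj_coaction[OF assms(1,2), of j] assms(2,3)
  by (auto simp: coact_def Psis_def)

text \<open>The transpose of \<open>\<gamma>\<close>. A comodule map \<open>\<phi>\<close> into H Y
  satisfies \<open>pr Y k \<cdot> \<phi> = AMap (G k) (pr Y 0 \<cdot> \<phi>) \<cdot> snd s
  k\<close>, so these components are forced by
  \<open>pr Y 0 \<cdot> \<phi> = \<gamma>\<close>.\<close>

definition cofree_lift :: "('o, 'm) text_obj \<Rightarrow> 'o \<Rightarrow> 'm \<Rightarrow> 'm"
  where "cofree_lift s Y \<gamma> = HSum A (fst s) (GS Y) (\<lambda>k. incl Y k \<cdot> (AMap (Gs G k) \<gamma> \<cdot> coact s k)) {0..n}"

context
  fixes s Y \<gamma>
  assumes s: "s \<in> TObj A n G \<Psi>" and \<gamma>: "\<gamma> \<in> Hom A (fst s) Y"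
begin

lemma cofree_lift_arr: "cofree_lift s Y \<gamma> \<in> Hom A (fst s) (GS Y)"
  and pr_cofree_lift: "k \<le> n \<Longrightarrow> pr Y k \<cdot> cofree_lift s Y \<gamma> = AMap (Gs G k) \<gamma> \<cdot> coact s k"
proof -
  have O: "fst s \<in> Obj A" "Y \<in> Obj A" using Hom_Obj[OF \<gamma>] by auto
  have c: "AMap (Gs G k) \<gamma> \<cdot> coact s k \<in> Hom A (fst s) (OMap (Gs G k) Y)" if "k \<in> {0..n}" for k
    using that s \<gamma> by (simp add: Hom_iff)
  show "cofree_lift s Y \<gamma> \<in> Hom A (fst s) (GS Y)"
    unfolding cofree_lift_def by (rule biproduct_tuple_in[OF GS_biproduct[OF O(2)] O(1) c])
  show "k \<le> n \<Longrightarrow> pr Y k \<cdot> cofree_lift s Y \<gamma> = AMap (Gs G k) \<gamma> \<cdot> coact s k"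
    unfolding cofree_lift_def using biproduct_pr_HSum[OF GS_biproduct[OF O(2)] O(1) c, of k] by simp
qed

lemma pr_0_cofree_lift: "pr Y 0 \<cdot> cofree_lift s Y \<gamma> = \<gamma>"
  using pr_cofree_lift[of 0] \<gamma> by (simp add: coact_def Hom_iff)

text \<open>In component \<open>k\<close> the left side is \<open>Psis i k\<close> after
  \<open>G (i + k) \<gamma>\<close> after the coaction with index \<open>i + k\<close>. Naturality
  moves \<open>\<gamma>\<close> to the front, and what remains is the coaction law of
  \<open>s\<close>; for \<open>i + k > n\<close> that law and the shape of \<open>lam\<close> both
  give zero.\<close>

lemma cofree_lift_comod_hom: "comod_hom s (HO Y) (cofree_lift s Y \<gamma>)"
  unfolding comod_hom_def
proof (intro conjI ballI)
  have O: "fst s \<in> Obj A" "Y \<in> Obj A" using Hom_Obj[OF \<gamma>] by auto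
  show "s \<in> TObj A n G \<Psi>" "HO Y \<in> TObj A n G \<Psi>" using s O by auto
  show "cofree_lift s Y \<gamma> \<in> Hom A (fst s) (fst (HO Y))" using cofree_lift_arr by simp
  have e: "cofree_lift s Y \<gamma> \<in> Arr A" "Dom A (cofree_lift s Y \<gamma>) = fst s" "Cod A (cofree_lift s Y \<gamma>) = GS Y"
    using cofree_lift_arr by (auto simp: Hom_iff)
  have g: "\<gamma> \<in> Arr A" "Dom A \<gamma> = fst s" "Cod A \<gamma> = Y" using \<gamma> by (auto simp: Hom_iff)
  fix i assume i: "i \<in> {1..n}"
  note si = TObjD(2-4)[OF s i]
  show "snd (HO Y) i \<cdot> cofree_lift s Y \<gamma> = AMap (G i) (cofree_lift s Y \<gamma>) \<cdot> snd s i"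
  proof (rule G_GS_eqI[OF i O(2)])
    show "snd (HO Y) i \<cdot> cofree_lift s Y \<gamma> \<in> Hom A (fst s) (OMap (G i) (GS Y))"
      "AMap (G i) (cofree_lift s Y \<gamma>) \<cdot> snd s i \<in> Hom A (fst s) (OMap (G i) (GS Y))"
      using i O e si by (simp_all add: Hom_iff)
    fix k assume k: "k \<le> n"
    have "AMap (G i) (pr Y k) \<cdot> (AMap (G i) (cofree_lift s Y \<gamma>) \<cdot> snd s i) =
        AMap (G i) (pr Y k \<cdot> cofree_lift s Y \<gamma>) \<cdot> snd s i"
      using i k O e si by simp
    also have "\<dots> = AMap (G i) (AMap (Gs G k) \<gamma>) \<cdot> (AMap (G i) (coact s k) \<cdot> snd s i)"
      using pr_cofree_lift[OF k] i k s g si by simp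
    finally have R: "AMap (G i) (pr Y k) \<cdot> (AMap (G i) (cofree_lift s Y \<gamma>) \<cdot> snd s i) =
      AMap (G i) (AMap (Gs G k) \<gamma>) \<cdot> (AMap (G i) (coact s k) \<cdot> snd s i)" .
    have L: "AMap (G i) (pr Y k) \<cdot> (lam Y i \<cdot> cofree_lift s Y \<gamma>) = (AMap (G i) (pr Y k) \<cdot> lam Y i) \<cdot> cofree_lift s Y \<gamma>"
      using i k O e by simp
    show "AMap (G i) (pr Y k) \<cdot> (snd (HO Y) i \<cdot> cofree_lift s Y \<gamma>) =
        AMap (G i) (pr Y k) \<cdot> (AMap (G i) (cofree_lift s Y \<gamma>) \<cdot> snd s i)"
    proof (cases "i + k \<le> n")
      case True
      have ik: "i + k \<in> {1..n}" using True i by simp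
      have "(AMap (G i) (pr Y k) \<cdot> lam Y i) \<cdot> cofree_lift s Y \<gamma> = Psis i k Y \<cdot> (pr Y (i + k) \<cdot> cofree_lift s Y \<gamma>)"
        using G_pr_lam[OF i O(2) k] True i O e by simp
      also have "\<dots> = (Psis i k Y \<cdot> AMap (G (i + k)) \<gamma>) \<cdot> snd s (i + k)"
        using pr_cofree_lift[OF True] i O g TObjD(2-4)[OF s ik] True ik by (simp add: coact_def)
      also have "\<dots> = (AMap (G i) (AMap (Gs G k) \<gamma>) \<cdot> Psis i k (fst s)) \<cdot> snd s (i + k)"
        using Psis_natural[OF i True g(1)] g by simp
      also have "\<dots> = AMap (G i) (AMap (Gs G k) \<gamma>) \<cdot> (AMap (G i) (coact s k) \<cdot> snd s i)"
        using coact_coaction[OF s i k] True i k O g TObjD(2-4)[OF s ik] ik by simp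
      finally show ?thesis using L R by simp
    next
      case False
      then show ?thesis
        unfolding R Hob_simps L using coact_coaction[OF s i k] G_pr_lam[OF i O(2) k] i k O e g by simp
    qed
  qed
qed

end

text \<open>The identity component of \<open>lam Y k\<close> gives
  \<open>pr Y k = AMap (G k) (pr Y 0) \<cdot> lam Y k\<close>, and a comodule map may be moved past
  \<open>lam Y k\<close>; thus its component 0 determines all others.\<close>

lemma cofree_eqI:
  assumes \<phi>: "comod_hom s (HO Y) \<phi>" and \<psi>: "comod_hom s (HO Y) \<psi>" and Y: "Y \<in> Obj A"
    and eq: "pr Y 0 \<cdot> \<phi> = pr Y 0 \<cdot> \<psi>"
  shows "\<phi> = \<psi>"
proof (rule GS_eqI[OF Y])
  show "\<phi> \<in> Hom A (fst s) (GS Y)" "\<psi> \<in> Hom A (fst s) (GS Y)"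
    using comod_hom_Hom[OF \<phi>] comod_hom_Hom[OF \<psi>] by auto
  have *: "pr Y k \<cdot> \<chi> = AMap (G k) (pr Y 0 \<cdot> \<chi>) \<cdot> snd s k"
    if \<chi>: "comod_hom s (HO Y) \<chi>" and k: "k \<in> {1..n}" for \<chi> k
  proof -
    note c = comod_homD[OF \<chi>]
    have "pr Y k = AMap (G k) (pr Y 0) \<cdot> lam Y k"
      using G_pr_lam[OF k Y, of 0] k Y by (simp add: Psis_def)
    then have "pr Y k \<cdot> \<chi> = AMap (G k) (pr Y 0) \<cdot> (lam Y k \<cdot> \<chi>)"
      using k Y c(3-5) by simp
    also have "\<dots> = AMap (G k) (pr Y 0) \<cdot> (AMap (G k) \<chi> \<cdot> snd s k)"
      using c(6)[OF k] by simp
    also have "\<dots> = AMap (G k) (pr Y 0 \<cdot> \<chi>) \<cdot> snd s k"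
      using k Y c(3-5) TObjD[OF c(1)] by simp
    finally show ?thesis .
  qed
  show "pr Y k \<cdot> \<phi> = pr Y k \<cdot> \<psi>" if "k \<le> n" for k
    using *[OF \<phi>, of k] *[OF \<psi>, of k] eq that by (cases "k = 0") auto
qed

section \<open>Trivial comodules\<close>

definition triv_comod :: "'o \<Rightarrow> ('o, 'm) text_obj"
  where "triv_comod W = (W, \<lambda>i\<in>{1..n}. Zero A W (OMap (G i) W))"

lemma triv_simps [simp]: "fst (triv_comod W) = W" "i \<in> {1..n} \<Longrightarrow> snd (triv_comod W) i = Zero A W (OMap (G i) W)"
  by (auto simp: triv_comod_def)

lemma triv_TObj [simp]: "W \<in> Obj A \<Longrightarrow> triv_comod W \<in> TObj A n G \<Psi>"
  unfolding triv_comod_def using Psi_arr by (intro TObjI) (auto simp: Hom_iff)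

text \<open>Generalised elements in K thereby become comodule maps, so composing them with comodule
  maps stays within K without further computation.\<close>

lemma triv_comod_hom_iff:
  assumes "t \<in> TObj A n G \<Psi>"
  shows "comod_hom (triv_comod W) t \<gamma> \<longleftrightarrow>
    \<gamma> \<in> Hom A W (fst t) \<and> (\<forall>i\<in>{1..n}. snd t i \<cdot> \<gamma> = Zero A W (OMap (G i) (fst t)))"
  using assms Hom_Obj[of \<gamma> W "fst t"] unfolding comod_hom_def by (auto simp: Hom_iff)

end

section \<open>Invertibility of comodule endomorphisms, and the functors \<open>K\<close> and \<open>H\<close>\<close>

context left_trivial_extension
begin

text \<open>\<open>Gs G i\<close> preserves the biproduct, so vanishing can be tested on components.
  The index \<open>i = 0\<close> gives the plain statement about the tuple of the
  \<open>g j\<close>; a positive \<open>i\<close> gives its image under \<open>G i\<close>, to be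
  matched with left exactness.\<close>

lemma joint_kernel:
  assumes fin: "finite J" and X: "X \<in> Obj A" and Y: "\<And>j. j \<in> J \<Longrightarrow> Y j \<in> Obj A"
    and g: "\<And>j. j \<in> J \<Longrightarrow> g j \<in> Hom A X (Y j)"
    and B: "is_biproduct A J Y B \<iota> \<pi>"
    and i: "i \<le> n" and h: "h \<in> Hom A W (OMap (Gs G i) X)"
  shows "AMap (Gs G i) (HSum A X B (\<lambda>j. \<iota> j \<cdot> g j) J) \<cdot> h = Zero A W (OMap (Gs G i) B) \<longleftrightarrow>
    (\<forall>j\<in>J. AMap (Gs G i) (g j) \<cdot> h = Zero A W (OMap (Gs G i) (Y j)))"
proof -
  let ?t = "HSum A X B (\<lambda>j. \<iota> j \<cdot> g j) J"
  note b = is_biproductD[OF B]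
  have "?t \<in> Hom A X B" using biproduct_tuple_in[OF B X g] .
  then have t: "?t \<in> Arr A" "Dom A ?t = X" "Cod A ?t = B" by (auto simp: Hom_iff)
  have \<pi>: "\<pi> j \<in> Arr A" "Dom A (\<pi> j) = B" "Cod A (\<pi> j) = Y j" if "j \<in> J" for j
    using b(5)[OF that] by (auto simp: Hom_iff)
  have W: "W \<in> Obj A" using Hom_Obj[OF h] by simp
  have h': "h \<in> Arr A" "Dom A h = W" "Cod A h = OMap (Gs G i) X" using h by (auto simp: Hom_iff)
  have GB: "is_biproduct A J (\<lambda>j. OMap (Gs G i) (Y j)) (OMap (Gs G i) B)
      (\<lambda>j. AMap (Gs G i) (\<iota> j)) (\<lambda>j. AMap (Gs G i) (\<pi> j))"
    using B G_biproduct[OF _ B, of i] i by (cases "i = 0") auto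
  have *: "AMap (Gs G i) (\<pi> j) \<cdot> (AMap (Gs G i) ?t \<cdot> h) = AMap (Gs G i) (g j) \<cdot> h" if j: "j \<in> J" for j
  proof -
    have "AMap (Gs G i) (\<pi> j) \<cdot> (AMap (Gs G i) ?t \<cdot> h) = AMap (Gs G i) (\<pi> j \<cdot> ?t) \<cdot> h"
      using \<pi>[OF j] t h' i by simp
    then show ?thesis using biproduct_pr_HSum[OF B X g j] by simp
  qed
  show ?thesis
  proof
    assume "AMap (Gs G i) ?t \<cdot> h = Zero A W (OMap (Gs G i) B)"
    then show "\<forall>j\<in>J. AMap (Gs G i) (g j) \<cdot> h = Zero A W (OMap (Gs G i) (Y j))"
      using *[symmetric] \<pi> W i by simp
  next
    assume z: "\<forall>j\<in>J. AMap (Gs G i) (g j) \<cdot> h = Zero A W (OMap (Gs G i) (Y j))"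
    show "AMap (Gs G i) ?t \<cdot> h = Zero A W (OMap (Gs G i) B)"
      by (rule biproduct_eqI[OF GB]) (use * z t h' i W \<pi> b(2) in \<open>auto simp: Hom_iff\<close>)
  qed
qed

text \<open>Inductively, \<open>v \<cdot> u\<close> is the identity on the common kernel of the structure maps \<open>g\<^sub>j\<close> with
  \<open>j > m\<close>. For \<open>h\<close> in the next step of the filtration, the coaction law puts \<open>g\<^sub>i \<cdot> h\<close> into \<open>G\<^sub>i\<close> of that
  kernel, so \<open>v u h - h\<close> is killed by all \<open>g\<^sub>i\<close> and hence fixed by \<open>u\<close>; this makes \<open>v - u v + 1\<close> a left
  inverse of \<open>u\<close> there.\<close>

lemma comodule_endomorphism_left_inverse:
  assumes u: "comod_hom s s u"
    and fix_prim: "\<And>W h. h \<in> Hom A W (fst s) \<Longrightarrow>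
      (\<forall>i\<in>{1..n}. snd s i \<cdot> h = Zero A W (OMap (G i) (fst s))) \<Longrightarrow> u \<cdot> h = h"
  shows "\<exists>v. comod_hom s s v \<and> v \<cdot> u = Ident A (fst s)"
proof -
  let ?X = "fst s"
  note cu = comod_homD(3-5)[OF u]
  have s: "s \<in> TObj A n G \<Psi>" using comod_homD(1)[OF u] .
  have X: "?X \<in> Obj A" using TObjD(1)[OF s] .
  have step: "\<exists>v. comod_hom s s v \<and> (\<forall>W. \<forall>h\<in>Hom A W ?X.
      (\<forall>j\<in>{m+1..n}. snd s j \<cdot> h = Zero A W (OMap (G j) ?X)) \<longrightarrow> v \<cdot> (u \<cdot> h) = h)" for m
  proof (induction m)
    \<comment> \<open>The condition on all of \<open>{1..n}\<close> puts \<open>h\<close> into K,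
      where \<open>u\<close> is the identity, so \<open>v = 1\<close> works.\<close>
    case 0
    have "Ident A ?X \<cdot> (u \<cdot> h) = h"
      if h: "h \<in> Hom A W ?X" and z: "\<forall>j\<in>{0+1..n}. snd s j \<cdot> h = Zero A W (OMap (G j) ?X)" for W h
      using fix_prim[OF h] z h by (simp add: Hom_iff)
    then show ?case using comod_hom_Ident[OF s] by blast
  next
    case (Suc m)
    then obtain v where v: "comod_hom s s v"
      and vu: "\<And>W h. h \<in> Hom A W ?X \<Longrightarrow>
        (\<forall>j\<in>{m+1..n}. snd s j \<cdot> h = Zero A W (OMap (G j) ?X)) \<Longrightarrow> v \<cdot> (u \<cdot> h) = h" by blast
    note cv = comod_homD(3-5)[OF v]
    have uv: "comod_hom s s (u \<cdot> v)" using comod_hom_Comp[OF v u] .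
    have v1: "comod_hom s s (v \<boxplus> Ident A ?X)" using comod_hom_Add[OF v comod_hom_Ident[OF s]] .
    \<comment> \<open>This is \<open>v' = v - u v + 1\<close>, expressed without
      subtraction.\<close>
    obtain v' where v'H: "v' \<in> Hom A ?X ?X" and eq: "(u \<cdot> v) \<boxplus> v' = v \<boxplus> Ident A ?X"
      using diff_exists[OF X X comod_hom_Hom[OF uv] comod_hom_Hom[OF v1]] .
    have v': "comod_hom s s v'" using comod_hom_diff[OF uv v1 v'H eq] .
    note cv' = comod_homD(3-5)[OF v']
    define w where "w = v \<cdot> u"
    have w: "comod_hom s s w" unfolding w_def using comod_hom_Comp[OF u v] .
    note cw = comod_homD(3-5)[OF w]
    have "v' \<cdot> (u \<cdot> h) = h"
      if h: "h \<in> Hom A W ?X"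
        and z: "\<forall>j\<in>{Suc m + 1..n}. snd s j \<cdot> h = Zero A W (OMap (G j) ?X)" for W h
    proof -
      have ch: "h \<in> Arr A" "Dom A h = W" "Cod A h = ?X" using h by (auto simp: Hom_iff)
      have W: "W \<in> Obj A" using Hom_Obj[OF h] by simp
      have wh: "w \<cdot> h \<in> Hom A W ?X" using cw ch by (simp add: Hom_iff)
      \<comment> \<open>Left exactness enters here. With \<open>\<kappa>\<close> the common kernel
        of the coactions with index above \<open>m\<close>, \<open>snd s i \<cdot> h\<close> factors
        through \<open>AMap (G i) \<kappa>\<close>. The induction hypothesis gives
        \<open>w \<cdot> \<kappa> = \<kappa>\<close>, so \<open>G i\<close> of \<open>w\<close>
        fixes \<open>snd s i \<cdot> h\<close>.\<close>
      have gw: "snd s i \<cdot> (w \<cdot> h) = snd s i \<cdot> h" if i: "i \<in> {1..n}" for i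
      proof -
        note si = TObjD(2-4)[OF s i]
        let ?Y = "\<lambda>j. OMap (G j) ?X" and ?J = "{m+1..n}"
        let ?B = "biprod_ob A ?J ?Y" and ?t = "HSum A ?X (biprod_ob A ?J ?Y) (\<lambda>j. biprod_in A ?J ?Y j \<cdot> snd s j) ?J"
        have B: "is_biproduct A ?J ?Y ?B (biprod_in A ?J ?Y) (biprod_pr A ?J ?Y)"
          by (rule biprod_is_biproduct) (use X in auto)
        have gJ: "snd s j \<in> Hom A ?X (?Y j)" if "j \<in> ?J" for j
          using that TObjD(2-4)[OF s, of j] by (simp add: Hom_iff)
        have YJ: "?Y j \<in> Obj A" if "j \<in> ?J" for j using that X by simp
        note jk = joint_kernel[OF _ X YJ gJ B]
        have "?t \<in> Hom A ?X ?B" using biproduct_tuple_in[OF B X gJ] .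
        from kernel_exists[OF this] obtain K \<kappa> where K: "is_kernel A ?X ?B ?t K \<kappa>" by blast
        note Kd = kernelD[OF K]
        have c\<kappa>: "\<kappa> \<in> Arr A" "Dom A \<kappa> = K" "Cod A \<kappa> = ?X" using Kd(2) by (auto simp: Hom_iff)
        have "v \<cdot> (u \<cdot> \<kappa>) = \<kappa>"
          by (rule vu[OF Kd(2)]) (use jk[of 0 \<kappa> K] Kd in simp)
        then have w\<kappa>: "w \<cdot> \<kappa> = \<kappa>" unfolding w_def using cu cv c\<kappa> by simp
        have GK: "is_kernel A (OMap (G i) ?X) (OMap (G i) ?B) (AMap (G i) ?t) (OMap (G i) K) (AMap (G i) \<kappa>)"
          using G_left_exact[OF i] K unfolding left_exact_def by blast
        have gh: "snd s i \<cdot> h \<in> Hom A W (OMap (G i) ?X)" using si ch by (simp add: Hom_iff)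
        have "AMap (G i) (snd s j) \<cdot> (snd s i \<cdot> h) = Zero A W (OMap (G i) (?Y j))" if j: "j \<in> ?J" for j
        proof -
          have j1: "j \<in> {1..n}" using j by simp
          have "AMap (G i) (snd s j) \<cdot> (snd s i \<cdot> h) = (AMap (G i) (snd s j) \<cdot> snd s i) \<cdot> h"
            using i j1 si TObjD(2-4)[OF s j1] ch by simp
          also have "\<dots> = Zero A W (OMap (G i) (?Y j))"
          proof (cases "i + j \<le> n")
            case True
            \<comment> \<open>From \<open>j \<ge> m + 1\<close> and \<open>i \<ge> 1\<close> follows
              \<open>i + j \<ge> m + 2 = Suc m + 1\<close>, the range in which \<open>h\<close> is
              killed; this gain of one index drives the induction.\<close>
            have ij: "i + j \<in> {1..n}" "i + j \<in> {Suc m + 1..n}" using True i j by auto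
            have "(\<Psi> i j ?X \<cdot> snd s (i + j)) \<cdot> h = \<Psi> i j ?X \<cdot> (snd s (i + j) \<cdot> h)"
              using Psi_arr[OF i j1 True X] TObjD(2-4)[OF s ij(1)] ch by simp
            also have "\<dots> = Zero A W (OMap (G i) (?Y j))"
              using bspec[OF z ij(2)] Psi_arr[OF i j1 True X] W by simp
            finally show ?thesis using TObj_coaction[OF s i j1] True by simp
          next
            case False
            then show ?thesis using TObj_coaction[OF s i j1] ch i j1 X by simp
          qed
          finally show ?thesis .
        qed
        then have "AMap (G i) ?t \<cdot> (snd s i \<cdot> h) = Zero A W (OMap (G i) ?B)"
          using jk[of i "snd s i \<cdot> h" W] gh i by simp
        then obtain y where y: "y \<in> Hom A W (OMap (G i) K)" and ky: "AMap (G i) \<kappa> \<cdot> y = snd s i \<cdot> h"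
          using kernel_lift[OF GK gh] by metis
        have cy: "y \<in> Arr A" "Dom A y = W" "Cod A y = OMap (G i) K" using y by (auto simp: Hom_iff)
        have "snd s i \<cdot> (w \<cdot> h) = (snd s i \<cdot> w) \<cdot> h" using si cw ch by simp
        also have "\<dots> = AMap (G i) w \<cdot> (snd s i \<cdot> h)"
          unfolding comod_homD(6)[OF w i] using si cw ch i by simp
        also have "\<dots> = AMap (G i) (w \<cdot> \<kappa>) \<cdot> y"
          unfolding ky[symmetric] using cw c\<kappa> cy i by simp
        also have "\<dots> = snd s i \<cdot> h" using w\<kappa> ky by simp
        finally show ?thesis .
      qed
      obtain d where d: "d \<in> Hom A W ?X" and hd: "h \<boxplus> d = w \<cdot> h"
        using diff_exists[OF W X h wh] .
      have cd: "d \<in> Arr A" "Dom A d = W" "Cod A d = ?X" using d by (auto simp: Hom_iff)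
      have "snd s i \<cdot> d = Zero A W (OMap (G i) ?X)" if i: "i \<in> {1..n}" for i
      proof -
        note si = TObjD(2-4)[OF s i]
        have O: "OMap (G i) ?X \<in> Obj A" using i X by simp
        have H: "snd s i \<cdot> h \<in> Hom A W (OMap (G i) ?X)" "snd s i \<cdot> d \<in> Hom A W (OMap (G i) ?X)"
          "Zero A W (OMap (G i) ?X) \<in> Hom A W (OMap (G i) ?X)"
          using si ch cd W O by (simp_all add: Hom_iff)
        have "snd s i \<cdot> h \<boxplus> snd s i \<cdot> d = snd s i \<cdot> h \<boxplus> Zero A W (OMap (G i) ?X)"
          using gw[OF i] hd[symmetric] si ch cd Add_Zero[OF W O H(1)] by (simp add: arr_Add_Comp)
        then show ?thesis using Add_cancel[OF W O H] by simp
      qed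
      then have ud: "u \<cdot> d = d" using fix_prim[OF d] by blast
      define uh where "uh = u \<cdot> h"
      have uhH: "uh \<in> Hom A W ?X" unfolding uh_def using cu ch by (simp add: Hom_iff)
      then have cuh: "uh \<in> Arr A" "Dom A uh = W" "Cod A uh = ?X" by (auto simp: Hom_iff)
      have vuh: "v \<cdot> uh = h \<boxplus> d" unfolding hd w_def uh_def using cu cv ch by simp
      have v'uh: "v' \<cdot> uh \<in> Hom A W ?X" using cv' cuh by (simp add: Hom_iff)
      \<comment> \<open>\<open>u v + v' = v + 1\<close> is applied to \<open>uh\<close> in both
        forms, using \<open>v \<cdot> uh = h \<boxplus> d\<close> and
        \<open>u \<cdot> d = d\<close>; then \<open>uh \<boxplus> d\<close> cancels.\<close>
      have "(uh \<boxplus> d) \<boxplus> v' \<cdot> uh = ((u \<cdot> v) \<boxplus> v') \<cdot> uh"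
        using cu cv cv' cuh vuh ud ch cd by (simp add: arr_Comp_Add arr_Add_Comp uh_def[symmetric])
      also have "\<dots> = (h \<boxplus> d) \<boxplus> uh"
        unfolding eq using cv cuh X vuh by (simp add: arr_Comp_Add)
      also have "\<dots> = (uh \<boxplus> d) \<boxplus> h"
        using Add_comm[OF W X h d] Add_comm[OF W X Add_in[OF d h] uhH] Add_assoc[OF W X uhH d h] by simp
      finally have "v' \<cdot> uh = h"
        using Add_cancel[OF W X Add_in[OF uhH d] v'uh h] by simp
      then show ?thesis by (simp add: uh_def)
    qed
    then show ?case using v' by blast
  qed
  obtain v where v: "comod_hom s s v" and vu: "\<And>W h. h \<in> Hom A W ?X \<Longrightarrow>
      (\<forall>j\<in>{n+1..n}. snd s j \<cdot> h = Zero A W (OMap (G j) ?X)) \<Longrightarrow> v \<cdot> (u \<cdot> h) = h"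
    using step[of n] by blast
  \<comment> \<open>The range \<open>{n+1..n}\<close> is empty, so the identity is an admissible
    \<open>h\<close>.\<close>
  have "v \<cdot> (u \<cdot> Ident A ?X) = Ident A ?X"
    by (rule vu) (use X in \<open>auto simp: Hom_iff\<close>)
  then show ?thesis using v cu by auto
qed

text \<open>A left inverse \<open>v\<close> of \<open>u\<close> is again the identity on K, because
  \<open>v h = v u h = h\<close> there. So \<open>v\<close> has a left inverse \<open>x\<close> as
  well, and \<open>x = x v u = u\<close>.\<close>

lemma comodule_endomorphism_inverse:
  assumes u: "comod_hom s s u"
    and fix_prim: "\<And>W h. h \<in> Hom A W (fst s) \<Longrightarrow>
      (\<forall>i\<in>{1..n}. snd s i \<cdot> h = Zero A W (OMap (G i) (fst s))) \<Longrightarrow> u \<cdot> h = h"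
  shows "\<exists>v. comod_hom s s v \<and> v \<cdot> u = Ident A (fst s) \<and> u \<cdot> v = Ident A (fst s)"
proof -
  obtain v where v: "comod_hom s s v" and vu: "v \<cdot> u = Ident A (fst s)"
    using comodule_endomorphism_left_inverse[OF u] fix_prim by blast
  note cu = comod_homD(3-5)[OF u] and cv = comod_homD(3-5)[OF v]
  have "v \<cdot> h = h" if h: "h \<in> Hom A W (fst s)"
      and z: "\<forall>i\<in>{1..n}. snd s i \<cdot> h = Zero A W (OMap (G i) (fst s))" for W h
  proof -
    have "v \<cdot> h = (v \<cdot> u) \<cdot> h" using fix_prim[OF h z] cu cv h by (simp add: Hom_iff)
    then show ?thesis using vu h by (simp add: Hom_iff)
  qed
  then obtain x where x: "comod_hom s s x" and xv: "x \<cdot> v = Ident A (fst s)"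
    using comodule_endomorphism_left_inverse[OF v] by blast
  note cx = comod_homD(3-5)[OF x]
  have "x = x \<cdot> (v \<cdot> u)" unfolding vu using cx by simp
  also have "\<dots> = (x \<cdot> v) \<cdot> u" using cx cu cv by simp
  also have "\<dots> = u" unfolding xv using cu by simp
  finally show ?thesis using v vu xv by auto
qed

section \<open>The functor K on objects\<close>

abbreviation "Kob s \<equiv> fst (Kker A n G s)"
abbreviation "Kin s \<equiv> snd (Kker A n G s)"

context
  fixes s assumes s: "s \<in> TObj A n G \<Psi>"
begin

text \<open>Hides the biproduct in the definition of K: of the map \<open>t\<close> it records only
  which generalised elements it kills.\<close>

lemma Kker_kernel:
  "\<exists>B t. is_kernel A (fst s) B t (Kob s) (Kin s) \<and>
    (\<forall>W. \<forall>h\<in>Hom A W (fst s). t \<cdot> h = Zero A W B \<longleftrightarrow>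
      (\<forall>i\<in>{1..n}. snd s i \<cdot> h = Zero A W (OMap (G i) (fst s))))"
proof -
  let ?X = "fst s"
  let ?Y = "\<lambda>i. OMap (G i) ?X"
  let ?B = "biprod_ob A {1..n} ?Y"
  let ?t = "HSum A ?X ?B (\<lambda>i. biprod_in A {1..n} ?Y i \<cdot> snd s i) {1..n}"
  have X: "?X \<in> Obj A" using TObjD(1)[OF s] .
  have Y: "?Y j \<in> Obj A" if "j \<in> {1..n}" for j using that X by simp
  have g: "snd s j \<in> Hom A ?X (?Y j)" if "j \<in> {1..n}" for j
    using TObjD(2-4)[OF s that] by (simp add: Hom_iff)
  have B: "is_biproduct A {1..n} ?Y ?B (biprod_in A {1..n} ?Y) (biprod_pr A {1..n} ?Y)"
    by (rule biprod_is_biproduct) (use Y in auto)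
  have t: "?t \<in> Hom A ?X ?B" using biproduct_tuple_in[OF B X g] .
  have "Kker A n G s = ker A ?X ?B ?t" by (simp add: Kker_def split_beta Let_def)
  then have "is_kernel A ?X ?B ?t (Kob s) (Kin s)" using ker_is_kernel[OF t] by simp
  moreover have "?t \<cdot> h = Zero A W ?B \<longleftrightarrow> (\<forall>i\<in>{1..n}. snd s i \<cdot> h = Zero A W (?Y i))"
    if "h \<in> Hom A W ?X" for W h
    using joint_kernel[OF _ X Y g B, of 0 h W] that by simp
  ultimately show ?thesis by blast
qed

lemma Kin_Hom: "Kin s \<in> Hom A (Kob s) (fst s)"
  using Kker_kernel kernelD(2) by blast

lemma Kob_Obj: "Kob s \<in> Obj A"
  using Hom_Obj[OF Kin_Hom] by simp

lemma Kin_comod_hom: "comod_hom (triv_comod (Kob s)) s (Kin s)"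
proof -
  obtain B t where k: "is_kernel A (fst s) B t (Kob s) (Kin s)"
    and t: "\<And>W h. h \<in> Hom A W (fst s) \<Longrightarrow> t \<cdot> h = Zero A W B \<longleftrightarrow>
      (\<forall>i\<in>{1..n}. snd s i \<cdot> h = Zero A W (OMap (G i) (fst s)))"
    using Kker_kernel by blast
  show ?thesis
    using t[OF Kin_Hom] kernelD(3)[OF k] Kin_Hom triv_comod_hom_iff[OF s] by simp
qed

text \<open>The adjunction between trivial comodules and K in the form used below; uniqueness of
  \<open>x\<close> is \<open>Kin_eqI\<close>.\<close>

lemma Kin_lift:
  assumes "comod_hom (triv_comod W) s h"
  obtains x where "x \<in> Hom A W (Kob s)" "Kin s \<cdot> x = h"
proof -
  obtain B t where k: "is_kernel A (fst s) B t (Kob s) (Kin s)"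
    and t: "\<And>W h. h \<in> Hom A W (fst s) \<Longrightarrow> t \<cdot> h = Zero A W B \<longleftrightarrow>
      (\<forall>i\<in>{1..n}. snd s i \<cdot> h = Zero A W (OMap (G i) (fst s)))"
    using Kker_kernel by blast
  have "h \<in> Hom A W (fst s)" "t \<cdot> h = Zero A W B"
    using assms t triv_comod_hom_iff[OF s] by auto
  then show ?thesis using kernel_lift[OF k] that by metis
qed

lemma Kin_eqI:
  assumes "x \<in> Hom A W (Kob s)" "y \<in> Hom A W (Kob s)" "Kin s \<cdot> x = Kin s \<cdot> y"
  shows "x = y"
proof -
  obtain B t where k: "is_kernel A (fst s) B t (Kob s) (Kin s)" using Kker_kernel by blast
  show ?thesis by (rule kernel_eqI[OF k assms])
qed

end

lemma triv_comod_hom_Comp: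
  assumes "comod_hom (triv_comod Z) t \<gamma>" "x \<in> Hom A W Z"
  shows "comod_hom (triv_comod W) t (\<gamma> \<cdot> x)"
proof -
  have x: "x \<in> Arr A" "Dom A x = W" "Cod A x = Z" "W \<in> Obj A" "Z \<in> Obj A"
    using assms(2) Hom_Obj[OF assms(2)] by (auto simp: Hom_iff)
  have "comod_hom (triv_comod W) (triv_comod Z) x"
    using x by (subst triv_comod_hom_iff) (auto simp: Hom_iff)
  from comod_hom_Comp[OF this assms(1)] show ?thesis .
qed

section \<open>The functor H on morphisms\<close>

definition Hmap :: "'m \<Rightarrow> 'm"
  where "Hmap \<alpha> = snd (snd (AMap (Hfun A n G \<Psi>) \<alpha>))"

lemma Hfun_simps [simp]:
  "OMap (Hfun A n G \<Psi>) = HO"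
  "AMap (Hfun A n G \<Psi>) \<alpha> = (HO (Dom A \<alpha>), HO (Cod A \<alpha>), Hmap \<alpha>)"
  by (simp_all add: Hfun_def Hmap_def Let_def)

context
  fixes \<alpha> assumes \<alpha>: "\<alpha> \<in> Arr A"
begin

lemma Hmap_Hom: "Hmap \<alpha> \<in> Hom A (GS (Dom A \<alpha>)) (GS (Cod A \<alpha>))"
  and pr_Hmap: "k \<le> n \<Longrightarrow> pr (Cod A \<alpha>) k \<cdot> Hmap \<alpha> = AMap (Gs G k) \<alpha> \<cdot> pr (Dom A \<alpha>) k"
proof -
  let ?X = "Dom A \<alpha>" and ?Y = "Cod A \<alpha>"
  have O: "?X \<in> Obj A" "?Y \<in> Obj A" using \<alpha> Dom_in Cod_in by auto
  have e: "Hmap \<alpha> = HSum A (GS ?X) (GS ?Y) (\<lambda>k. incl ?Y k \<cdot> (AMap (Gs G k) \<alpha> \<cdot> pr ?X k)) {0..n}"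
    by (simp add: Hmap_def Hfun_def Let_def)
  have c: "AMap (Gs G k) \<alpha> \<cdot> pr ?X k \<in> Hom A (GS ?X) (OMap (Gs G k) ?Y)" if "k \<in> {0..n}" for k
    using that \<alpha> O by (simp add: Hom_iff)
  show "Hmap \<alpha> \<in> Hom A (GS ?X) (GS ?Y)"
    unfolding e by (rule biproduct_tuple_in[OF GS_biproduct[OF O(2)] GS_Obj[OF O(1)] c])
  show "k \<le> n \<Longrightarrow> pr ?Y k \<cdot> Hmap \<alpha> = AMap (Gs G k) \<alpha> \<cdot> pr ?X k"
    unfolding e using biproduct_pr_HSum[OF GS_biproduct[OF O(2)] GS_Obj[OF O(1)] c, of k] by simp
qed

text \<open>In component \<open>k\<close> the two sides are the two ways around the naturality
  square of \<open>Psis i k\<close> at \<open>\<alpha>\<close>, after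
  \<open>pr (Dom A \<alpha>) (i + k)\<close>, and zero if \<open>i + k > n\<close>.\<close>

lemma Hmap_comod_hom: "comod_hom (HO (Dom A \<alpha>)) (HO (Cod A \<alpha>)) (Hmap \<alpha>)"
  unfolding comod_hom_def
proof (intro conjI ballI)
  let ?X = "Dom A \<alpha>" and ?Y = "Cod A \<alpha>"
  have O: "?X \<in> Obj A" "?Y \<in> Obj A" using \<alpha> Dom_in Cod_in by auto
  show "HO ?X \<in> TObj A n G \<Psi>" "HO ?Y \<in> TObj A n G \<Psi>" using O by auto
  show "Hmap \<alpha> \<in> Hom A (fst (HO ?X)) (fst (HO ?Y))" using Hmap_Hom by simp
  have H: "Hmap \<alpha> \<in> Arr A" "Dom A (Hmap \<alpha>) = GS ?X" "Cod A (Hmap \<alpha>) = GS ?Y"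
    using Hmap_Hom by (auto simp: Hom_iff)
  fix i assume i: "i \<in> {1..n}"
  show "snd (HO ?Y) i \<cdot> Hmap \<alpha> = AMap (G i) (Hmap \<alpha>) \<cdot> snd (HO ?X) i"
  proof (rule G_GS_eqI[OF i O(2)])
    show "snd (HO ?Y) i \<cdot> Hmap \<alpha> \<in> Hom A (GS ?X) (OMap (G i) (GS ?Y))"
      "AMap (G i) (Hmap \<alpha>) \<cdot> snd (HO ?X) i \<in> Hom A (GS ?X) (OMap (G i) (GS ?Y))"
      using i O H by (simp_all add: Hom_iff)
    fix k assume k: "k \<le> n"
    have "AMap (G i) (pr ?Y k) \<cdot> (AMap (G i) (Hmap \<alpha>) \<cdot> lam ?X i) =
        AMap (G i) (pr ?Y k \<cdot> Hmap \<alpha>) \<cdot> lam ?X i"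
      using i k O H by simp
    also have "\<dots> = AMap (G i) (AMap (Gs G k) \<alpha>) \<cdot> (AMap (G i) (pr ?X k) \<cdot> lam ?X i)"
      unfolding pr_Hmap[OF k] using i k O \<alpha> by simp
    finally have R: "AMap (G i) (pr ?Y k) \<cdot> (AMap (G i) (Hmap \<alpha>) \<cdot> lam ?X i) =
      AMap (G i) (AMap (Gs G k) \<alpha>) \<cdot> (AMap (G i) (pr ?X k) \<cdot> lam ?X i)" .
    have L: "AMap (G i) (pr ?Y k) \<cdot> (lam ?Y i \<cdot> Hmap \<alpha>) = (AMap (G i) (pr ?Y k) \<cdot> lam ?Y i) \<cdot> Hmap \<alpha>"
      using i k O H by simp
    show "AMap (G i) (pr ?Y k) \<cdot> (snd (HO ?Y) i \<cdot> Hmap \<alpha>) =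
        AMap (G i) (pr ?Y k) \<cdot> (AMap (G i) (Hmap \<alpha>) \<cdot> snd (HO ?X) i)"
    proof (cases "i + k \<le> n")
      case True
      have "(AMap (G i) (pr ?Y k) \<cdot> lam ?Y i) \<cdot> Hmap \<alpha> = Psis i k ?Y \<cdot> (pr ?Y (i + k) \<cdot> Hmap \<alpha>)"
        using G_pr_lam[OF i O(2) k] True i O H by simp
      also have "\<dots> = (Psis i k ?Y \<cdot> AMap (G (i + k)) \<alpha>) \<cdot> pr ?X (i + k)"
        unfolding pr_Hmap[OF True] using i O \<alpha> True by simp
      also have "\<dots> = (AMap (G i) (AMap (Gs G k) \<alpha>) \<cdot> Psis i k ?X) \<cdot> pr ?X (i + k)"
        using Psis_natural[OF i True \<alpha>] by simp
      also have "\<dots> = AMap (G i) (AMap (Gs G k) \<alpha>) \<cdot> (AMap (G i) (pr ?X k) \<cdot> lam ?X i)"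
        using G_pr_lam[OF i O(1) k] True i k O \<alpha> by simp
      finally show ?thesis unfolding Hob_simps R L .
    next
      case False
      then show ?thesis
        unfolding Hob_simps R L using G_pr_lam[OF i O(1) k] G_pr_lam[OF i O(2) k] i k O H \<alpha> by simp
    qed
  qed
qed

text \<open>Together with \<open>cofree_eqI\<close> this characterises \<open>Hmap \<alpha>\<close>,
  so that functoriality, additivity and preservation of products are checked in component 0
  alone.\<close>

lemma pr_0_Hmap: "pr (Cod A \<alpha>) 0 \<cdot> Hmap \<alpha> = \<alpha> \<cdot> pr (Dom A \<alpha>) 0"
  using pr_Hmap[of 0] by simp

end

lemma Hfun_functor: "is_functor A T (Hfun A n G \<Psi>)"
proof -
  interpret T: preadditive_category T by (rule T_preadditive)
  show ?thesis
  proof (intro is_functor.intro is_functor_axioms.intro category_axioms T.category_axioms)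
    show "OMap (Hfun A n G \<Psi>) X \<in> Obj T" if "X \<in> Obj A" for X using that by simp
    show "AMap (Hfun A n G \<Psi>) f \<in> Hom T (OMap (Hfun A n G \<Psi>) X) (OMap (Hfun A n G \<Psi>) Y)"
      if "f \<in> Hom A X Y" for f X Y
      using that Hmap_comod_hom[of f] by (auto simp: T_Hom_iff Hom_iff)
    show "AMap (Hfun A n G \<Psi>) (Ident A X) = Ident T (OMap (Hfun A n G \<Psi>) X)" if X: "X \<in> Obj A" for X
    proof -
      have "Hmap (Ident A X) = Ident A (GS X)"
      proof (rule cofree_eqI[of "HO X" X])
        show "comod_hom (HO X) (HO X) (Hmap (Ident A X))" using Hmap_comod_hom[of "Ident A X"] X by simp
        show "comod_hom (HO X) (HO X) (Ident A (GS X))" using comod_hom_Ident[of "HO X"] X by simp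
        show "pr X 0 \<cdot> Hmap (Ident A X) = pr X 0 \<cdot> Ident A (GS X)" using pr_0_Hmap[of "Ident A X"] X by simp
      qed (rule X)
      then show ?thesis using X by simp
    qed
    show "AMap (Hfun A n G \<Psi>) (g \<cdot> f) = AMap (Hfun A n G \<Psi>) g \<cdot>\<^bsub>T\<^esub> AMap (Hfun A n G \<Psi>) f"
      if f: "f \<in> Hom A X Y" and g: "g \<in> Hom A Y Z" for f g X Y Z
    proof -
      have c: "f \<in> Arr A" "Dom A f = X" "Cod A f = Y" "g \<in> Arr A" "Dom A g = Y" "Cod A g = Z"
        and O: "X \<in> Obj A" "Y \<in> Obj A" "Z \<in> Obj A"
        using f g Hom_Obj[OF f] Hom_Obj[OF g] by (auto simp: Hom_iff)
      have H: "Hmap f \<in> Arr A" "Dom A (Hmap f) = GS X" "Cod A (Hmap f) = GS Y"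
        "Hmap g \<in> Arr A" "Dom A (Hmap g) = GS Y" "Cod A (Hmap g) = GS Z"
        using Hmap_Hom[OF c(1)] Hmap_Hom[OF c(4)] c by (auto simp: Hom_iff)
      have "Hmap (g \<cdot> f) = Hmap g \<cdot> Hmap f"
      proof (rule cofree_eqI[of "HO X" Z])
        show "comod_hom (HO X) (HO Z) (Hmap (g \<cdot> f))" using Hmap_comod_hom[of "g \<cdot> f"] c by simp
        show "comod_hom (HO X) (HO Z) (Hmap g \<cdot> Hmap f)"
          using comod_hom_Comp[OF Hmap_comod_hom[of f] ] Hmap_comod_hom[of g] c by simp
        have "pr Z 0 \<cdot> (Hmap g \<cdot> Hmap f) = (pr Z 0 \<cdot> Hmap g) \<cdot> Hmap f" using H O by simp
        also have "\<dots> = g \<cdot> (pr Y 0 \<cdot> Hmap f)" using pr_0_Hmap[OF c(4)] c H O by simp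
        also have "\<dots> = (g \<cdot> f) \<cdot> pr X 0" using pr_0_Hmap[OF c(1)] c O by simp
        finally show "pr Z 0 \<cdot> Hmap (g \<cdot> f) = pr Z 0 \<cdot> (Hmap g \<cdot> Hmap f)"
          using pr_0_Hmap[of "g \<cdot> f"] c by simp
      qed (rule O)
      then show ?thesis using c by simp
    qed
  qed
qed

lemma Hfun_additive: "additive A T (Hfun A n G \<Psi>)"
  unfolding additive_def
proof (intro ballI)
  fix X Y f g assume O: "X \<in> Obj A" "Y \<in> Obj A" and f: "f \<in> Hom A X Y" and g: "g \<in> Hom A X Y"
  have c: "f \<in> Arr A" "Dom A f = X" "Cod A f = Y" "g \<in> Arr A" "Dom A g = X" "Cod A g = Y"
    using f g by (auto simp: Hom_iff)
  have H: "Hmap f \<in> Arr A" "Dom A (Hmap f) = GS X" "Cod A (Hmap f) = GS Y"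
    "Hmap g \<in> Arr A" "Dom A (Hmap g) = GS X" "Cod A (Hmap g) = GS Y"
    using Hmap_Hom[OF c(1)] Hmap_Hom[OF c(4)] c by (auto simp: Hom_iff)
  have "Hmap (f \<boxplus> g) = Hmap f \<boxplus> Hmap g"
  proof (rule cofree_eqI[of "HO X" Y])
    show "comod_hom (HO X) (HO Y) (Hmap (f \<boxplus> g))" using Hmap_comod_hom[of "f \<boxplus> g"] c by simp
    show "comod_hom (HO X) (HO Y) (Hmap f \<boxplus> Hmap g)"
      using comod_hom_Add[of "HO X" "HO Y"] Hmap_comod_hom[of f] Hmap_comod_hom[of g] c by simp
    show "pr Y 0 \<cdot> Hmap (f \<boxplus> g) = pr Y 0 \<cdot> (Hmap f \<boxplus> Hmap g)"
      using pr_0_Hmap[of "f \<boxplus> g"] pr_0_Hmap[of f] pr_0_Hmap[of g] c H O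
      by (simp add: arr_Add_Comp arr_Comp_Add)
  qed (rule O)
  then show "AMap (Hfun A n G \<Psi>) (f \<boxplus> g) = AMap (Hfun A n G \<Psi>) f \<boxplus>\<^bsub>T\<^esub> AMap (Hfun A n G \<Psi>) g"
    using c by simp
qed

end

section \<open>Products and retracts\<close>

lemma (in is_functor) isomorphic_OMap:
  assumes "isomorphic C X Y"
  shows "isomorphic D (OMap F X) (OMap F Y)"
proof -
  from assms obtain f g where O: "X \<in> Obj C" "Y \<in> Obj C" and f: "f \<in> Hom C X Y" and g: "g \<in> Hom C Y X"
    and fg: "g \<cdot>\<^bsub>C\<^esub> f = Ident C X" "f \<cdot>\<^bsub>C\<^esub> g = Ident C Y"
    unfolding isomorphic_def by blast
  show ?thesis
    by (rule cod.isomorphicI[OF AMap_in[OF f] AMap_in[OF g]])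
      (use AMap_Comp[OF f g] AMap_Comp[OF g f] fg AMap_Ident O in auto)
qed

context left_trivial_extension
begin

lemma Hfun_product:
  assumes P: "is_product A S Y P p"
  shows "is_product T S (\<lambda>a. HO (Y a)) (HO P) (\<lambda>a. AMap (Hfun A n G \<Psi>) (p a))"
proof -
  interpret T: preadditive_category T by (rule T_preadditive)
  interpret H: is_functor A T "Hfun A n G \<Psi>" by (rule Hfun_functor)
  note P' = is_productD[OF P]
  have pa: "p a \<in> Arr A" "Dom A (p a) = P" "Cod A (p a) = Y a" "Y a \<in> Obj A" if "a \<in> S" for a
    using P'(2)[OF that] Hom_Obj[OF P'(2)[OF that]] by (auto simp: Hom_iff)
  \<comment> \<open>Passing to component 0 turns \<open>Hmap (p a)\<close> into \<open>p a\<close>;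
    this translates between the product conditions in the extension and those in
    \<open>A\<close>.\<close>
  have pH: "pr (Y a) 0 \<cdot> (Hmap (p a) \<cdot> u) = p a \<cdot> (pr P 0 \<cdot> u)"
    if a: "a \<in> S" and u: "comod_hom s (HO P) u" for a s u
  proof -
    have H: "Hmap (p a) \<in> Arr A" "Dom A (Hmap (p a)) = GS P" "Cod A (Hmap (p a)) = GS (Y a)"
      using Hmap_Hom[OF pa(1)[OF a]] pa[OF a] by (auto simp: Hom_iff)
    note cu = comod_homD(3-5)[OF u]
    have "pr (Y a) 0 \<cdot> (Hmap (p a) \<cdot> u) = (pr (Y a) 0 \<cdot> Hmap (p a)) \<cdot> u"
      using H cu pa[OF a] by simp
    also have "\<dots> = p a \<cdot> (pr P 0 \<cdot> u)"
      using pr_0_Hmap[OF pa(1)[OF a]] pa[OF a] cu P'(1) by simp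
    finally show ?thesis .
  qed
  show ?thesis
    unfolding is_product_def
  proof (intro conjI ballI allI impI)
    show "HO P \<in> Obj T" using P' by simp
    show "AMap (Hfun A n G \<Psi>) (p a) \<in> Hom T (HO P) (HO (Y a))" if "a \<in> S" for a
      using H.AMap_in[OF P'(2)[OF that]] by simp
    fix s q assume s: "s \<in> Obj T" and q: "\<forall>a\<in>S. q a \<in> Hom T s (HO (Y a))"
    define \<gamma> where "\<gamma> a = snd (snd (q a))" for a
    have \<gamma>: "q a = (s, HO (Y a), \<gamma> a)" "comod_hom s (HO (Y a)) (\<gamma> a)" if "a \<in> S" for a
      using q that by (auto simp: T_Hom_iff \<gamma>_def)
    have c\<gamma>: "pr (Y a) 0 \<cdot> \<gamma> a \<in> Hom A (fst s) (Y a)" if "a \<in> S" for a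
      using comod_homD(3-5)[OF \<gamma>(2)[OF that]] pa(4)[OF that] by (simp add: Hom_iff)
    have O: "fst s \<in> Obj A" and sT: "s \<in> TObj A n G \<Psi>" using s TObjD(1)[of s] by auto
    obtain u where u: "u \<in> Hom A (fst s) P" and pu: "\<And>a. a \<in> S \<Longrightarrow> p a \<cdot> u = pr (Y a) 0 \<cdot> \<gamma> a"
      using is_product_lift[OF P O c\<gamma>] by metis
    note e = cofree_lift_comod_hom[OF sT u]
    show "\<exists>!u. u \<in> Hom T s (HO P) \<and> (\<forall>a\<in>S. AMap (Hfun A n G \<Psi>) (p a) \<cdot>\<^bsub>T\<^esub> u = q a)"
    proof (rule ex1I[of _ "(s, HO P, cofree_lift s P u)"], intro conjI ballI)
      show "(s, HO P, cofree_lift s P u) \<in> Hom T s (HO P)" using e by (simp add: T_Hom_iff)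
      fix a assume a: "a \<in> S"
      have "Hmap (p a) \<cdot> cofree_lift s P u = \<gamma> a"
      proof (rule cofree_eqI[OF _ \<gamma>(2)[OF a] pa(4)[OF a]])
        show "comod_hom s (HO (Y a)) (Hmap (p a) \<cdot> cofree_lift s P u)"
          using comod_hom_Comp[OF e] Hmap_comod_hom[OF pa(1)[OF a]] pa[OF a] by simp
        show "pr (Y a) 0 \<cdot> (Hmap (p a) \<cdot> cofree_lift s P u) = pr (Y a) 0 \<cdot> \<gamma> a"
          using pH[OF a e] pr_0_cofree_lift[OF sT u] pu[OF a] by simp
      qed
      then show "AMap (Hfun A n G \<Psi>) (p a) \<cdot>\<^bsub>T\<^esub> (s, HO P, cofree_lift s P u) = q a"
        using \<gamma>(1)[OF a] pa[OF a] by simp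
    next
      fix x assume x: "x \<in> Hom T s (HO P) \<and> (\<forall>a\<in>S. AMap (Hfun A n G \<Psi>) (p a) \<cdot>\<^bsub>T\<^esub> x = q a)"
      then obtain \<xi> where \<xi>: "x = (s, HO P, \<xi>)" "comod_hom s (HO P) \<xi>" by (auto simp: T_Hom_iff)
      note c\<xi> = comod_homD(3-5)[OF \<xi>(2)]
      have "pr P 0 \<cdot> \<xi> = u"
      proof (rule is_product_eqI[OF P _ u])
        show "pr P 0 \<cdot> \<xi> \<in> Hom A (fst s) P" using c\<xi> P'(1) by (simp add: Hom_iff)
        fix a assume a: "a \<in> S"
        have "Hmap (p a) \<cdot> \<xi> = \<gamma> a" using x \<xi>(1) \<gamma>(1)[OF a] a pa[OF a] by auto
        then show "p a \<cdot> (pr P 0 \<cdot> \<xi>) = p a \<cdot> u" using pH[OF a \<xi>(2)] pu[OF a] by simp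
      qed
      then have "\<xi> = cofree_lift s P u"
        using cofree_eqI[OF \<xi>(2) e P'(1)] pr_0_cofree_lift[OF sT u] by simp
      then show "x = (s, HO P, cofree_lift s P u)" using \<xi>(1) by simp
    qed
  qed
qed

text \<open>Up to the identification \<open>K (H Y) \<cong> Y\<close> given by the projection, this is preservation of
  products by the right adjoint \<open>K\<close> of \<open>W \<mapsto> triv_comod W\<close>.\<close>

lemma Kob_product:
  assumes P: "is_product T S (\<lambda>a. HO (Y a)) P p" and Y: "\<And>a. a \<in> S \<Longrightarrow> Y a \<in> Obj A"
  shows "is_product A S Y (Kob P) (\<lambda>a. pr (Y a) 0 \<cdot> (snd (snd (p a)) \<cdot> Kin P))"
proof -
  interpret T: preadditive_category T by (rule T_preadditive)
  note P' = T.is_productD[OF P]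
  have PT: "P \<in> TObj A n G \<Psi>" using P'(1) by simp
  define \<pi> where "\<pi> a = snd (snd (p a))" for a
  have \<pi>: "p a = (P, HO (Y a), \<pi> a)" "comod_hom P (HO (Y a)) (\<pi> a)" if "a \<in> S" for a
    using P'(2)[OF that] by (auto simp: T_Hom_iff \<pi>_def)
  note c\<pi> = comod_homD(3-5)[OF \<pi>(2)]
  have K: "Kin P \<in> Arr A" "Dom A (Kin P) = Kob P" "Cod A (Kin P) = fst P" "Kob P \<in> Obj A"
    using Kin_Hom[OF PT] Kob_Obj[OF PT] by (auto simp: Hom_iff)
  note KC = Kin_comod_hom[OF PT]
  show ?thesis
    unfolding is_product_def \<pi>_def[symmetric]
  proof (intro conjI ballI allI impI)
    show "Kob P \<in> Obj A" by (rule K)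
    show "pr (Y a) 0 \<cdot> (\<pi> a \<cdot> Kin P) \<in> Hom A (Kob P) (Y a)" if "a \<in> S" for a
      using c\<pi>[OF that] K Y[OF that] by (simp add: Hom_iff)
    fix W q assume W: "W \<in> Obj A" and q: "\<forall>a\<in>S. q a \<in> Hom A W (Y a)"
    note tW = triv_TObj[OF W]
    have qa: "q a \<in> Hom A (fst (triv_comod W)) (Y a)" if "a \<in> S" for a using q that by simp
    note eq = cofree_lift_comod_hom[OF tW qa] pr_0_cofree_lift[OF tW qa]
    \<comment> \<open>A morphism \<open>W -> Y a\<close> transposes to a comodule map from the
      trivial comodule on \<open>W\<close> to H (Y a), to which the product property of
      \<open>P\<close> applies.\<close>
    define q' where "q' a = (triv_comod W, HO (Y a), cofree_lift (triv_comod W) (Y a) (q a))" for a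
    have q': "q' a \<in> Hom T (triv_comod W) (HO (Y a))" if "a \<in> S" for a
      using eq(1)[OF that] by (simp add: T_Hom_iff q'_def)
    have "triv_comod W \<in> Obj T" using tW by simp
    from T.is_product_lift[OF P this q'] obtain x where x: "x \<in> Hom T (triv_comod W) P"
      and px: "\<And>a. a \<in> S \<Longrightarrow> p a \<cdot>\<^bsub>T\<^esub> x = (triv_comod W, HO (Y a), cofree_lift (triv_comod W) (Y a) (q a))"
      unfolding q'_def by metis
    then obtain \<xi> where \<xi>: "x = (triv_comod W, P, \<xi>)" "comod_hom (triv_comod W) P \<xi>" by (auto simp: T_Hom_iff)
    obtain u where u: "u \<in> Hom A W (Kob P)" and Ku: "Kin P \<cdot> u = \<xi>"
      using Kin_lift[OF PT \<xi>(2)] .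
    have proj: "(pr (Y a) 0 \<cdot> (\<pi> a \<cdot> Kin P)) \<cdot> v = pr (Y a) 0 \<cdot> (\<pi> a \<cdot> (Kin P \<cdot> v))"
      if "a \<in> S" "v \<in> Hom A W (Kob P)" for a v
      using c\<pi>[OF that(1)] K Y[OF that(1)] that(2) by (simp add: Hom_iff)
    show "\<exists>!u. u \<in> Hom A W (Kob P) \<and> (\<forall>a\<in>S. (pr (Y a) 0 \<cdot> (\<pi> a \<cdot> Kin P)) \<cdot> u = q a)"
    proof (rule ex1I[of _ u], intro conjI ballI)
      show "u \<in> Hom A W (Kob P)" by (rule u)
      fix a assume a: "a \<in> S"
      have "\<pi> a \<cdot> \<xi> = cofree_lift (triv_comod W) (Y a) (q a)" using px[OF a] \<pi>(1)[OF a] \<xi>(1) by simp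
      then show "(pr (Y a) 0 \<cdot> (\<pi> a \<cdot> Kin P)) \<cdot> u = q a"
        using proj[OF a u] Ku eq(2)[OF a] by simp
    next
      fix v assume v: "v \<in> Hom A W (Kob P) \<and> (\<forall>a\<in>S. (pr (Y a) 0 \<cdot> (\<pi> a \<cdot> Kin P)) \<cdot> v = q a)"
      then have vH: "v \<in> Hom A W (Kob P)" by simp
      note Kv = triv_comod_hom_Comp[OF KC vH]
      \<comment> \<open>Uniqueness is inherited from the extension: \<open>v\<close> and
        \<open>u\<close> induce the same comodule map into \<open>P\<close>, and
        \<open>Kin P\<close> can be cancelled.\<close>
      have "(triv_comod W, P, Kin P \<cdot> v) = x"
      proof (rule T.is_product_eqI[OF P _ x])
        show "(triv_comod W, P, Kin P \<cdot> v) \<in> Hom T (triv_comod W) P" using Kv by (simp add: T_Hom_iff)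
        fix a assume a: "a \<in> S"
        have "\<pi> a \<cdot> (Kin P \<cdot> v) = cofree_lift (triv_comod W) (Y a) (q a)"
        proof (rule cofree_eqI[OF comod_hom_Comp[OF Kv \<pi>(2)[OF a]] eq(1)[OF a] Y[OF a]])
          show "pr (Y a) 0 \<cdot> (\<pi> a \<cdot> (Kin P \<cdot> v)) = pr (Y a) 0 \<cdot> cofree_lift (triv_comod W) (Y a) (q a)"
            using v a proj[OF a vH] eq(2)[OF a] by simp
        qed
        then show "p a \<cdot>\<^bsub>T\<^esub> (triv_comod W, P, Kin P \<cdot> v) = p a \<cdot>\<^bsub>T\<^esub> x"
          using px[OF a] \<pi>(1)[OF a] by simp
      qed
      then have "Kin P \<cdot> v = Kin P \<cdot> u" using Ku \<xi>(1) by simp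
      then show "v = u" using Kin_eqI[OF PT vH u] by simp
    qed
  qed
qed

text \<open>The comparison maps between \<open>s\<close> and \<open>H (K s)\<close> induced by the retraction are mutually inverse
  on the images of \<open>K\<close>, hence invertible.\<close>

lemma retract_of_Hob:
  assumes sZ: "category.retract T s (HO Z)" and Z: "Z \<in> Obj A"
  shows "retract (Kob s) Z" "isomorphic T s (HO (Kob s))"
proof -
  interpret T: preadditive_category T by (rule T_preadditive)
  from sZ obtain i r where i: "comod_hom s (HO Z) i" and r: "comod_hom (HO Z) s r"
    and ri: "r \<cdot> i = Ident A (fst s)"
    unfolding T.retract_def by (auto simp: T_Hom_iff)
  let ?L = "Kob s" and ?k = "Kin s"
  have s: "s \<in> TObj A n G \<Psi>" using comod_homD(1)[OF i] .
  have L: "?L \<in> Obj A" using Kob_Obj[OF s] .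
  note kH = Kin_Hom[OF s] and kC = Kin_comod_hom[OF s]
  have ck: "?k \<in> Arr A" "Dom A ?k = ?L" "Cod A ?k = fst s" using kH by (auto simp: Hom_iff)
  have ci: "i \<in> Arr A" "Dom A i = fst s" "Cod A i = GS Z"
    and cr: "r \<in> Arr A" "Dom A r = GS Z" "Cod A r = fst s"
    using comod_homD(3-5)[OF i] comod_homD(3-5)[OF r] by auto
  \<comment> \<open>\<open>\<eta> Y\<close> is the inclusion of \<open>Y\<close>, regarded as K (H
    Y), into H Y. The fact \<open>fac\<close> below says that every comodule map from a trivial
    comodule factors through it.\<close>
  define \<eta> where "\<eta> Y = cofree_lift (triv_comod Y) Y (Ident A Y)" for Y
  have \<eta>: "comod_hom (triv_comod Y) (HO Y) (\<eta> Y)" "pr Y 0 \<cdot> \<eta> Y = Ident A Y" if "Y \<in> Obj A" for Y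
    unfolding \<eta>_def using cofree_lift_comod_hom[OF triv_TObj[OF that]] pr_0_cofree_lift[OF triv_TObj[OF that]] Ident_in[OF that]
    by auto
  have c\<eta>: "\<eta> Y \<in> Arr A" "Dom A (\<eta> Y) = Y" "Cod A (\<eta> Y) = GS Y" if "Y \<in> Obj A" for Y
    using comod_homD(3-5)[OF \<eta>(1)[OF that]] by auto
  have fac: "\<eta> Y \<cdot> (pr Y 0 \<cdot> h) = h" if h: "comod_hom (triv_comod W) (HO Y) h" and Y: "Y \<in> Obj A" for W Y h
  proof (rule cofree_eqI[OF _ h Y])
    note ch = comod_homD(3-5)[OF h]
    have p: "pr Y 0 \<cdot> h \<in> Hom A W Y" using ch Y by (simp add: Hom_iff)
    show "comod_hom (triv_comod W) (HO Y) (\<eta> Y \<cdot> (pr Y 0 \<cdot> h))" by (rule triv_comod_hom_Comp[OF \<eta>(1)[OF Y] p])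
    have "pr Y 0 \<cdot> (\<eta> Y \<cdot> (pr Y 0 \<cdot> h)) = (pr Y 0 \<cdot> \<eta> Y) \<cdot> (pr Y 0 \<cdot> h)"
      using c\<eta>[OF Y] ch Y by simp
    then show "pr Y 0 \<cdot> (\<eta> Y \<cdot> (pr Y 0 \<cdot> h)) = pr Y 0 \<cdot> h" using \<eta>(2)[OF Y] ch Y by simp
  qed
  \<comment> \<open>Under the identification of K (H Z) with \<open>Z\<close>, \<open>t\<close> is K
    r and \<open>e\<close> below is K i; hence \<open>t \<cdot> e = 1\<close>.\<close>
  obtain t where tH: "t \<in> Hom A Z ?L" and kt: "?k \<cdot> t = r \<cdot> \<eta> Z"
    using Kin_lift[OF s comod_hom_Comp[OF \<eta>(1)[OF Z] r]] .
  have ct: "t \<in> Arr A" "Dom A t = Z" "Cod A t = ?L" using tH by (auto simp: Hom_iff)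
  define e where "e = pr Z 0 \<cdot> (i \<cdot> ?k)"
  have eH: "e \<in> Hom A ?L Z" unfolding e_def using ci ck Z by (simp add: Hom_iff)
  then have ce: "e \<in> Arr A" "Dom A e = ?L" "Cod A e = Z" by (auto simp: Hom_iff)
  have \<eta>e: "\<eta> Z \<cdot> e = i \<cdot> ?k" unfolding e_def by (rule fac[OF comod_hom_Comp[OF kC i] Z])
  have te: "t \<cdot> e = Ident A ?L"
  proof (rule Kin_eqI[OF s])
    show "t \<cdot> e \<in> Hom A ?L ?L" "Ident A ?L \<in> Hom A ?L ?L" using ct ce L by (simp_all add: Hom_iff)
    have "?k \<cdot> (t \<cdot> e) = (?k \<cdot> t) \<cdot> e" using ck ct ce by simp
    also have "\<dots> = r \<cdot> (\<eta> Z \<cdot> e)" unfolding kt using cr c\<eta>[OF Z] ce by simp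
    also have "\<dots> = (r \<cdot> i) \<cdot> ?k" unfolding \<eta>e using cr ci ck by simp
    also have "\<dots> = ?k \<cdot> Ident A ?L" unfolding ri using ck by simp
    finally show "?k \<cdot> (t \<cdot> e) = ?k \<cdot> Ident A ?L" .
  qed
  show "retract ?L Z" unfolding retract_def using eH tH te by blast
  \<comment> \<open>\<open>a\<close> is H e followed by \<open>r\<close>. \<open>b\<close> is the
    comodule map with component \<open>t \<cdot> (pr Z 0 \<cdot> i)\<close>, which is the one of
    \<open>i\<close> followed by H t.\<close>
  define a where "a = r \<cdot> Hmap e"
  define b where "b = cofree_lift s ?L (t \<cdot> (pr Z 0 \<cdot> i))"
  have He: "comod_hom (HO ?L) (HO Z) (Hmap e)" using Hmap_comod_hom[OF ce(1)] ce by simp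
  have cHe: "Hmap e \<in> Arr A" "Dom A (Hmap e) = GS ?L" "Cod A (Hmap e) = GS Z"
    using comod_homD(3-5)[OF He] by auto
  have a: "comod_hom (HO ?L) s a" unfolding a_def by (rule comod_hom_Comp[OF He r])
  have tpi: "t \<cdot> (pr Z 0 \<cdot> i) \<in> Hom A (fst s) ?L" using ct ci Z by (simp add: Hom_iff)
  have b: "comod_hom s (HO ?L) b" unfolding b_def by (rule cofree_lift_comod_hom[OF s tpi])
  note ca = comod_homD(3-5)[OF a] and cb = comod_homD(3-5)[OF b]
  have "Hmap e \<cdot> \<eta> ?L = \<eta> Z \<cdot> e"
  proof (rule cofree_eqI[OF comod_hom_Comp[OF \<eta>(1)[OF L] He] triv_comod_hom_Comp[OF \<eta>(1)[OF Z] eH] Z])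
    have "pr Z 0 \<cdot> (Hmap e \<cdot> \<eta> ?L) = (pr Z 0 \<cdot> Hmap e) \<cdot> \<eta> ?L" using cHe c\<eta>[OF L] Z by simp
    also have "\<dots> = e \<cdot> (pr ?L 0 \<cdot> \<eta> ?L)" using pr_0_Hmap[OF ce(1)] ce c\<eta>[OF L] L by simp
    also have "\<dots> = (pr Z 0 \<cdot> \<eta> Z) \<cdot> e" using \<eta>(2)[OF L] \<eta>(2)[OF Z] ce by simp
    also have "\<dots> = pr Z 0 \<cdot> (\<eta> Z \<cdot> e)" using c\<eta>[OF Z] ce Z by simp
    finally show "pr Z 0 \<cdot> (Hmap e \<cdot> \<eta> ?L) = pr Z 0 \<cdot> (\<eta> Z \<cdot> e)" .
  qed
  then have "a \<cdot> \<eta> ?L = r \<cdot> (i \<cdot> ?k)" unfolding a_def using \<eta>e cr cHe c\<eta>[OF L] by simp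
  also have "\<dots> = (r \<cdot> i) \<cdot> ?k" using cr ci ck by simp
  finally have a\<eta>: "a \<cdot> \<eta> ?L = ?k" unfolding ri using ck by simp
  have bk: "b \<cdot> ?k = \<eta> ?L"
  proof (rule cofree_eqI[OF comod_hom_Comp[OF kC b] \<eta>(1)[OF L] L])
    have "pr ?L 0 \<cdot> (b \<cdot> ?k) = (pr ?L 0 \<cdot> b) \<cdot> ?k" using cb ck L by simp
    also have "\<dots> = t \<cdot> e" unfolding b_def pr_0_cofree_lift[OF s tpi] e_def using ct ci ck Z by simp
    finally show "pr ?L 0 \<cdot> (b \<cdot> ?k) = pr ?L 0 \<cdot> \<eta> ?L" using te \<eta>(2)[OF L] by simp
  qed
  \<comment> \<open>By \<open>a\<eta>\<close> and \<open>bk\<close>, the maps \<open>a\<close> and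
    \<open>b\<close> exchange the inclusions \<open>\<eta> ?L\<close> and \<open>?k\<close> of
    \<open>?L\<close>, and everything killed by the structure maps factors through such an
    inclusion.\<close>
  have ab: "(a \<cdot> b) \<cdot> h = h"
    if h: "h \<in> Hom A W (fst s)" and z: "\<forall>i\<in>{1..n}. snd s i \<cdot> h = Zero A W (OMap (G i) (fst s))" for W h
  proof -
    have "comod_hom (triv_comod W) s h" using triv_comod_hom_iff[OF s] h z by simp
    then obtain x where x: "x \<in> Hom A W ?L" and kx: "?k \<cdot> x = h" using Kin_lift[OF s] by blast
    have cx: "x \<in> Arr A" "Dom A x = W" "Cod A x = ?L" using x by (auto simp: Hom_iff)
    have "(a \<cdot> b) \<cdot> (?k \<cdot> x) = (a \<cdot> (b \<cdot> ?k)) \<cdot> x" using ca cb ck cx by simp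
    then show ?thesis using bk a\<eta> kx by simp
  qed
  have ba: "(b \<cdot> a) \<cdot> h = h"
    if h: "h \<in> Hom A W (fst (HO ?L))"
      and z: "\<forall>i\<in>{1..n}. snd (HO ?L) i \<cdot> h = Zero A W (OMap (G i) (fst (HO ?L)))" for W h
  proof -
    have hC: "comod_hom (triv_comod W) (HO ?L) h" using triv_comod_hom_iff[OF Hob_TObj[OF L]] h z by simp
    note ch = comod_homD(3-5)[OF hC]
    define x where "x = pr ?L 0 \<cdot> h"
    have cx: "x \<in> Arr A" "Dom A x = W" "Cod A x = ?L" unfolding x_def using ch L by simp_all
    have hx: "\<eta> ?L \<cdot> x = h" unfolding x_def by (rule fac[OF hC L])
    have "(b \<cdot> a) \<cdot> (\<eta> ?L \<cdot> x) = (b \<cdot> (a \<cdot> \<eta> ?L)) \<cdot> x" using ca cb cx c\<eta>[OF L] by simp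
    then show ?thesis using bk a\<eta> hx by simp
  qed
  \<comment> \<open>The invertibility lemma concerns endomorphisms, so it is applied to both
    composites: \<open>b \<cdot> v\<close> is a right inverse of \<open>a\<close>,
    \<open>w \<cdot> b\<close> a left inverse, and the two coincide.\<close>
  obtain v where v: "comod_hom s s v" "(a \<cdot> b) \<cdot> v = Ident A (fst s)"
    using comodule_endomorphism_inverse[OF comod_hom_Comp[OF b a]] ab by blast
  obtain w where w: "comod_hom (HO ?L) (HO ?L) w" "w \<cdot> (b \<cdot> a) = Ident A (fst (HO ?L))"
    using comodule_endomorphism_inverse[OF comod_hom_Comp[OF a b]] ba by blast
  note cv = comod_homD(3-5)[OF v(1)] and cw = comod_homD(3-5)[OF w(1)]
  have av: "a \<cdot> (b \<cdot> v) = Ident A (fst s)" using v ca cb cv by simp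
  have wa: "(w \<cdot> b) \<cdot> a = Ident A (GS ?L)" using w ca cb cw by simp
  have "b \<cdot> v = ((w \<cdot> b) \<cdot> a) \<cdot> (b \<cdot> v)" unfolding wa using cb cv by simp
  also have "\<dots> = (w \<cdot> b) \<cdot> (a \<cdot> (b \<cdot> v))" using ca cb cv cw by simp
  also have "\<dots> = w \<cdot> b" unfolding av using cb cw by simp
  finally have "(b \<cdot> v) \<cdot> a = Ident A (GS ?L)" using wa by simp
  then show "isomorphic T s (HO ?L)"
    using comod_isomorphicI[OF comod_hom_Comp[OF v(1) b] a] av by simp
qed

theorem Prod_Hob_iff:
  assumes s: "s \<in> TObj A n G \<Psi>" and E: "E \<in> Obj A"
  shows "s \<in> Prod T (HO E) \<longleftrightarrow> Kob s \<in> Prod A E \<and> isomorphic T s (HO (Kob s))"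
proof
  interpret T: preadditive_category T by (rule T_preadditive)
  assume "s \<in> Prod T (HO E)"
  then obtain S :: "('o, 'm) text_arr set" and P p s' where P: "is_product T S (\<lambda>_. HO E) P p"
    and s': "direct_summand T s' P" and ss': "isomorphic T s s'"
    unfolding Prod_def by blast
  \<comment> \<open>\<open>S\<close> consists of morphisms of the extension;
    \<open>Prod_any_index\<close> below replaces it by a set of morphisms of
    \<open>A\<close>.\<close>
  have Z: "is_product A S (\<lambda>_. E) (Kob P) (\<lambda>a. pr E 0 \<cdot> (snd (snd (p a)) \<cdot> Kin P))"
    by (rule Kob_product[OF P E])
  have ZO: "Kob P \<in> Obj A" using is_productD(1)[OF Z] .
  \<comment> \<open>Both objects are \<open>S\<close>-fold powers of \<open>HO E\<close>:
    \<open>P\<close> by assumption, the other because H preserves the product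
    \<open>Z\<close>.\<close>
  have "isomorphic T P (HO (Kob P))" by (rule T.is_product_unique[OF P Hfun_product[OF Z]])
  then have "T.retract s (HO (Kob P))"
    using T.retract_trans T.isomorphic_retract T.direct_summand_retract[OF s'] ss' by metis
  note r = retract_of_Hob[OF this ZO]
  have "Kob s \<in> Prod A E"
    by (rule Prod_any_index[OF Z retract_direct_summand[OF r(1)] isomorphic_refl[OF Kob_Obj[OF s]]])
  then show "Kob s \<in> Prod A E \<and> isomorphic T s (HO (Kob s))" using r(2) by simp
next
  interpret T: preadditive_category T by (rule T_preadditive)
  interpret H: is_functor A T "Hfun A n G \<Psi>" by (rule Hfun_functor)
  assume R: "Kob s \<in> Prod A E \<and> isomorphic T s (HO (Kob s))"
  then obtain S :: "'m set" and P p X where P: "is_product A S (\<lambda>_. E) P p"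
    and X: "direct_summand A X P" and KX: "isomorphic A (Kob s) X"
    unfolding Prod_def by blast
  from X obtain Y \<iota> \<pi> where "is_biproduct A {0, 1} (\<lambda>j. if j = 0 then X else Y) P \<iota> \<pi>"
    unfolding direct_summand_def by blast
  \<comment> \<open>The complement of \<open>HO X\<close> in \<open>HO P\<close> is
    \<open>HO Y\<close>, carried over by additivity of H.\<close>
  from additive_functor_biproduct[OF preadditive_category_axioms T_preadditive Hfun_functor
      Hfun_additive this]
  have "is_biproduct T {0, 1} (\<lambda>j. if j = 0 then HO X else HO Y) (HO P)
      (\<lambda>j. AMap (Hfun A n G \<Psi>) (\<iota> j)) (\<lambda>j. AMap (Hfun A n G \<Psi>) (\<pi> j))"
    by (simp add: if_distrib[of HO])
  then have "direct_summand T (HO X) (HO P)" unfolding direct_summand_def by blast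
  moreover have "isomorphic T s (HO X)"
    using T.isomorphic_trans[OF conjunct2[OF R]] H.isomorphic_OMap[OF KX] by simp
  ultimately show "s \<in> Prod T (HO E)"
    using Prod_any_index[OF Hfun_product[OF P]] by blast
qed

end

theorem theorem3p4:
  fixes A :: "('o, 'm) preadd_cat"
    and n :: nat
    and G F :: "nat \<Rightarrow> ('o, 'm) endoftor"
    and \<Psi> :: "nat \<Rightarrow> nat \<Rightarrow> 'o \<Rightarrow> 'm"
    and E X :: 'o
    and f :: "nat \<Rightarrow> 'm"
  assumes "abelian_category A"
    and "n \<ge> 1"
    and "\<And>i. i \<in> {1..n} \<Longrightarrow> is_functor A A (G i)"
    and "\<And>i. i \<in> {1..n} \<Longrightarrow> additive A A (G i)"
    and "\<And>i. i \<in> {1..n} \<Longrightarrow> left_exact A A (G i)"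
    and "\<And>i. i \<in> {1..n} \<Longrightarrow> is_functor A A (F i)"
    and "\<And>i. i \<in> {1..n} \<Longrightarrow> adjoint A A (F i) (G i)"
    and "nat_trans_family A n G \<Psi>"
    and "coassociative A n G \<Psi>"
    and "E \<in> Obj A"
    and "(X, f) \<in> Obj (triv_ext A n G \<Psi>)"
  shows "(X, f) \<in> Prod (triv_ext A n G \<Psi>) (OMap (Hfun A n G \<Psi>) E) \<longleftrightarrow>
    OMap (Kfun A n G) (X, f) \<in> Prod A E \<and>
    isomorphic (triv_ext A n G \<Psi>) (X, f) (OMap (Hfun A n G \<Psi>) (OMap (Kfun A n G) (X, f)))"
proof -
  interpret left_trivial_extension A n G \<Psi>
    using assms by (intro left_trivial_extension.intro left_trivial_extension_axioms.intro)
  show ?thesis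
    using Prod_Hob_iff[of "(X, f)" E] assms by (simp add: Kfun_def)
qed

end
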